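(* Suppose that $\varphi(z)=(az+b)/(cz+d)$ is a linear-fractional self-map of $\mathbb{D}$, not an automorphism, which satisfies $\varphi(\zeta)=\eta$ for some $\zeta,\eta\in\partial\mathbb{D}$. Let $$s=\frac{\overline{c}\,\overline{\zeta}+\overline{d}}{-\overline{b}\eta+\overline{d}}.$$ Then there exists a compact operator $K$ on $H^2$ such that $C_\varphi^*=sC_\sigma+K$, where $\sigma(z)=(\overline{a}z-\overline{c})/(-\overline{b}z+\overline{d})$.
   Context: $H^2$ is the Hardy space on the unit disk $\mathbb{D}$ and $C_\varphi f=f\circ\varphi$ is the composition operator on $H^2$. A linear-fractional map is a map $z\mapsto(az+b)/(cz+d)$ with $ad-bc\neq0$; it is a self-map of $\mathbb{D}$ if it maps $\mathbb{D}$ into $\mathbb{D}$, and an automorphism if it maps $\mathbb{D}$ onto $\mathbb{D}$. The map $\sigma$ (the Krein adjoint of $\varphi$) is then also a self-map of $\mathbb{D}$, and $\sigma(\eta)=\zeta$. *)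

theory Defs
  imports "HOL-Complex_Analysis.Complex_Analysis"
begin

definition taylor_coeff :: "(complex \<Rightarrow> complex) \<Rightarrow> nat \<Rightarrow> complex" where
  "taylor_coeff f n = (deriv ^^ n) f 0 / fact n"

(* The condition outside the disk only makes the representation of a function on the disk by a
   total function unique. *)
definition hardy_set :: "(complex \<Rightarrow> complex) set" where
  "hardy_set = {f. f holomorphic_on ball 0 1 \<and> (\<forall>z. z \<notin> ball 0 1 \<longrightarrow> f z = 0) \<and>
                   summable (\<lambda>n. (cmod (taylor_coeff f n))\<^sup>2)}"

lemma taylor_coeff_zero [simp]: "taylor_coeff (\<lambda>z. 0) n = 0"
  by (simp add: taylor_coeff_def)

lemma zero_in_hardy_set: "(\<lambda>z. 0) \<in> hardy_set"
  by (simp add: hardy_set_def)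

typedef hardy2 = hardy_set
  morphisms hardy_fun Abs_hardy2
  using zero_in_hardy_set by blast

definition hardy_coeff :: "hardy2 \<Rightarrow> nat \<Rightarrow> complex" where
  "hardy_coeff f = taylor_coeff (hardy_fun f)"

lemma taylor_coeff_add:
  assumes "f holomorphic_on ball 0 1" "g holomorphic_on ball 0 1"
  shows "taylor_coeff (\<lambda>z. f z + g z) n = taylor_coeff f n + taylor_coeff g n"
  using assms by (simp add: taylor_coeff_def higher_deriv_add [of f "ball 0 1" g] add_divide_distrib)

lemma taylor_coeff_cmult:
  assumes "f holomorphic_on ball 0 1"
  shows "taylor_coeff (\<lambda>z. c * f z) n = c * taylor_coeff f n"
  using assms by (simp add: taylor_coeff_def higher_deriv_cmult [of f "ball 0 1"])

lemma cmod_add_sq_le: "(cmod (x + y))\<^sup>2 \<le> 2 * (cmod x)\<^sup>2 + 2 * (cmod y)\<^sup>2"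
proof -
  have "(cmod (x + y))\<^sup>2 \<le> (cmod x + cmod y)\<^sup>2"
    by (simp add: norm_triangle_ineq power_mono)
  also have "\<dots> \<le> 2 * (cmod x)\<^sup>2 + 2 * (cmod y)\<^sup>2"
    using sum_squares_bound [of "cmod x" "cmod y"] by (simp add: power2_sum)
  finally show ?thesis .
qed

lemma hardy_set_add:
  assumes "f \<in> hardy_set" "g \<in> hardy_set"
  shows "(\<lambda>z. f z + g z) \<in> hardy_set"
proof -
  have "summable (\<lambda>n. 2 * (cmod (taylor_coeff f n))\<^sup>2 + 2 * (cmod (taylor_coeff g n))\<^sup>2)"
    using assms by (intro summable_add summable_mult) (auto simp: hardy_set_def)
  then have "summable (\<lambda>n. (cmod (taylor_coeff f n + taylor_coeff g n))\<^sup>2)"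
    by (rule summable_comparison_test') (simp add: cmod_add_sq_le)
  then show ?thesis
    using assms by (auto simp: hardy_set_def taylor_coeff_add intro!: holomorphic_intros)
qed

lemma hardy_set_cmult:
  assumes "f \<in> hardy_set"
  shows "(\<lambda>z. c * f z) \<in> hardy_set"
  using assms
  by (auto simp: hardy_set_def taylor_coeff_cmult norm_mult power_mult_distrib
           intro!: holomorphic_intros summable_mult)

lemma hardy2_eqI: "(\<And>z. hardy_fun f z = hardy_fun g z) \<Longrightarrow> f = g"
  by (metis ext hardy_fun_inject)

lemma holomorphic_hardy_fun: "hardy_fun f holomorphic_on ball 0 1"
  using hardy_fun [of f] by (simp add: hardy_set_def)

lemma summable_hardy_coeff: "summable (\<lambda>n. (cmod (hardy_coeff f n))\<^sup>2)"
  using hardy_fun [of f] by (simp add: hardy_set_def hardy_coeff_def)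

definition hardy_scale :: "complex \<Rightarrow> hardy2 \<Rightarrow> hardy2" (infixr "*\<^sub>H" 75) where
  "c *\<^sub>H f = Abs_hardy2 (\<lambda>z. c * hardy_fun f z)"

definition hardy_inner :: "hardy2 \<Rightarrow> hardy2 \<Rightarrow> complex" where
  "hardy_inner f g = (\<Sum>n. hardy_coeff f n * cnj (hardy_coeff g n))"

lemma hardy_fun_scale: "hardy_fun (c *\<^sub>H f) z = c * hardy_fun f z"
  by (simp add: hardy_scale_def Abs_hardy2_inverse hardy_set_cmult hardy_fun)

instantiation hardy2 :: real_vector
begin

definition "0 = Abs_hardy2 (\<lambda>z. 0)"
definition "f + g = Abs_hardy2 (\<lambda>z. hardy_fun f z + hardy_fun g z)"
definition "- f = (-1) *\<^sub>H f" for f :: hardy2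
definition "f - g = f + (-1) *\<^sub>H g" for f g :: hardy2
definition "r *\<^sub>R f = complex_of_real r *\<^sub>H f"

lemma hardy_fun_zero [simp]: "hardy_fun 0 z = 0"
  by (simp add: zero_hardy2_def Abs_hardy2_inverse zero_in_hardy_set)

lemma hardy_fun_add: "hardy_fun (f + g) z = hardy_fun f z + hardy_fun g z"
  by (simp add: plus_hardy2_def Abs_hardy2_inverse hardy_set_add hardy_fun)

instance
  by standard
    (rule hardy2_eqI, simp add: hardy_fun_add hardy_fun_scale uminus_hardy2_def
       minus_hardy2_def scaleR_hardy2_def algebra_simps)+

end

interpretation hardy: vector_space hardy_scale
  by standard (rule hardy2_eqI, simp add: hardy_fun_add hardy_fun_scale algebra_simps)+

lemma hardy_coeff_add: "hardy_coeff (f + g) n = hardy_coeff f n + hardy_coeff g n"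
proof -
  have "hardy_fun (f + g) = (\<lambda>z. hardy_fun f z + hardy_fun g z)"
    by (simp add: fun_eq_iff hardy_fun_add)
  then show ?thesis
    by (simp add: hardy_coeff_def taylor_coeff_add holomorphic_hardy_fun)
qed

lemma hardy_coeff_scale: "hardy_coeff (c *\<^sub>H f) n = c * hardy_coeff f n"
proof -
  have "hardy_fun (c *\<^sub>H f) = (\<lambda>z. c * hardy_fun f z)"
    by (simp add: fun_eq_iff hardy_fun_scale)
  then show ?thesis
    by (simp add: hardy_coeff_def taylor_coeff_cmult holomorphic_hardy_fun)
qed

lemma hardy_coeff_zero [simp]: "hardy_coeff 0 n = 0"
  using hardy_coeff_scale [of 0 0 n] by simp

lemma hardy2_eqI_coeff:
  assumes "\<And>n. hardy_coeff f n = hardy_coeff g n"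
  shows "f = g"
proof (rule hardy2_eqI)
  fix z
  show "hardy_fun f z = hardy_fun g z"
  proof (cases "z \<in> ball 0 1")
    case True
    show ?thesis
      by (rule holomorphic_fun_eq_on_ball [OF holomorphic_hardy_fun holomorphic_hardy_fun True])
        (use assms in \<open>simp add: hardy_coeff_def taylor_coeff_def\<close>)
  next
    case False
    then show ?thesis
      using hardy_fun [of f] hardy_fun [of g] by (simp add: hardy_set_def)
  qed
qed

lemma summable_hardy_inner: "summable (\<lambda>n. hardy_coeff f n * cnj (hardy_coeff g n))"
proof (rule summable_comparison_test')
  show "summable (\<lambda>n. (cmod (hardy_coeff f n))\<^sup>2 + (cmod (hardy_coeff g n))\<^sup>2)"
    by (intro summable_add summable_hardy_coeff)
  fix n
  show "norm (hardy_coeff f n * cnj (hardy_coeff g n))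
          \<le> (cmod (hardy_coeff f n))\<^sup>2 + (cmod (hardy_coeff g n))\<^sup>2"
    using sum_squares_bound [of "cmod (hardy_coeff f n)" "cmod (hardy_coeff g n)"]
      mult_nonneg_nonneg [OF norm_ge_zero norm_ge_zero, of "hardy_coeff f n" "hardy_coeff g n"]
    unfolding norm_mult complex_mod_cnj mult.assoc by linarith
qed

lemma hardy_inner_add_left: "hardy_inner (f + g) h = hardy_inner f h + hardy_inner g h"
  unfolding hardy_inner_def
  by (simp add: hardy_coeff_add distrib_right suminf_add [OF summable_hardy_inner summable_hardy_inner])

lemma hardy_inner_scale_left: "hardy_inner (c *\<^sub>H f) g = c * hardy_inner f g"
  unfolding hardy_inner_def
  by (simp add: hardy_coeff_scale mult.assoc suminf_mult [OF summable_hardy_inner])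

lemma hardy_inner_commute: "hardy_inner f g = cnj (hardy_inner g f)"
proof -
  have "(\<lambda>n. cnj (hardy_coeff g n * cnj (hardy_coeff f n))) sums cnj (hardy_inner g f)"
    unfolding hardy_inner_def sums_cnj by (intro summable_sums summable_hardy_inner)
  then show ?thesis
    unfolding hardy_inner_def by (simp add: sums_iff mult.commute)
qed

lemma hardy_inner_self: "hardy_inner f f = of_real (\<Sum>n. (cmod (hardy_coeff f n))\<^sup>2)"
  unfolding hardy_inner_def suminf_of_real [OF summable_hardy_coeff] complex_norm_square
  by (rule refl)

lemma hardy_inner_self_eq_0: "hardy_inner f f = 0 \<longleftrightarrow> f = 0"
proof
  assume "hardy_inner f f = 0"
  then have "hardy_coeff f n = 0" for n
    using suminf_eq_zero_iff [OF summable_hardy_coeff [of f]]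
    by (simp add: hardy_inner_self)
  then show "f = 0"
    by (intro hardy2_eqI_coeff) simp
qed (simp add: hardy_inner_self)

instantiation hardy2 :: real_inner
begin

definition "inner f g = Re (hardy_inner f g)"
definition "norm f = sqrt (Re (hardy_inner f f))"
definition "sgn f = f /\<^sub>R norm f" for f :: hardy2
definition "dist f g = norm (f - g)" for f g :: hardy2
definition "uniformity = (INF e\<in>{0<..}. principal {(x :: hardy2, y). dist x y < e})"
definition "open (U :: hardy2 set) \<longleftrightarrow>
  (\<forall>x\<in>U. \<forall>\<^sub>F (x', y) in uniformity. x' = x \<longrightarrow> y \<in> U)"

instance
proof
  fix f g h :: hardy2 and r :: real and U :: "hardy2 set"
  show "inner f g = inner g f"
    unfolding inner_hardy2_def by (subst hardy_inner_commute) simp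
  show "inner (f + g) h = inner f h + inner g h"
    by (simp add: inner_hardy2_def hardy_inner_add_left)
  show "inner (r *\<^sub>R f) g = r * inner f g"
    by (simp add: inner_hardy2_def scaleR_hardy2_def hardy_inner_scale_left)
  show "0 \<le> inner f f"
    by (simp add: inner_hardy2_def hardy_inner_self suminf_nonneg summable_hardy_coeff)
  show "inner f f = 0 \<longleftrightarrow> f = 0"
    using hardy_inner_self_eq_0 [of f] by (simp add: inner_hardy2_def hardy_inner_self)
  show "norm f = sqrt (inner f f)"
    by (simp add: norm_hardy2_def inner_hardy2_def)
qed (rule sgn_hardy2_def dist_hardy2_def uniformity_hardy2_def open_hardy2_def)+

end

(* Meaningful when every f \<circ> \<phi> is again in the Hardy space, which holds for every holomorphic
   self-map of the disk by Littlewood's subordination theorem. *)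
definition composition_operator :: "(complex \<Rightarrow> complex) \<Rightarrow> hardy2 \<Rightarrow> hardy2" where
  "composition_operator \<phi> f =
     Abs_hardy2 (\<lambda>z. if z \<in> ball 0 1 then hardy_fun f (\<phi> z) else 0)"

definition compact_operator :: "(hardy2 \<Rightarrow> hardy2) \<Rightarrow> bool" where
  "compact_operator K \<longleftrightarrow>
     Vector_Spaces.linear hardy_scale hardy_scale K \<and> compact (closure (K ` ball 0 1))"

(* The library constant adjoint is taken with respect to the real inner product. The adjoint below
   is determined by its defining property (see hardy_adjoint_eqI), and exists for every bounded
   complex-linear operator. *)
definition hardy_adjoint :: "(hardy2 \<Rightarrow> hardy2) \<Rightarrow> hardy2 \<Rightarrow> hardy2" where
  "hardy_adjoint T = (THE S. \<forall>f g. hardy_inner (T f) g = hardy_inner f (S g))"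

lemma hardy_adjoint_eqI:
  assumes "\<And>f g. hardy_inner (T f) g = hardy_inner f (S g)"
  shows "hardy_adjoint T = S"
  unfolding hardy_adjoint_def
proof (rule the_equality)
  fix S'
  assume S': "\<forall>f g. hardy_inner (T f) g = hardy_inner f (S' g)"
  show "S' = S"
  proof
    fix g
    have "hardy_inner f (S' g) = hardy_inner f (S g)" for f
      by (rule trans [OF S' [rule_format, symmetric] assms])
    then have "inner f (S' g - S g) = 0" for f
      unfolding inner_diff_right by (simp add: inner_hardy2_def)
    then show "S' g = S g"
      using inner_eq_zero_iff [of "S' g - S g"] by simp
  qed
qed (use assms in blast)

end

theory Submission
  imports Defs
begin

text \<open>
  Write \<open>D z = - cnj b * z + cnj d\<close>, \<open>N z = cnj a * z - cnj c\<close>, so that \<open>\<sigma> = N / D\<close>, and let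
  \<open>B\<close> be the backward shift. Testing against reproducing kernels gives Cowen's formula for the
  adjoint, \<open>C\<^sub>\<phi>\<^sup>* f = (1 / D) * ((cnj c * B f + cnj d * f) \<circ> \<sigma>)\<close>
  (\<open>hardy_adjoint_composition\<close>). On the monomial \<open>z ^ (n + 1)\<close> both \<open>C\<^sub>\<phi>\<^sup>*\<close> and \<open>s C\<^sub>\<sigma>\<close> give
  \<open>\<sigma> ^ n\<close> times a rational function; the number \<open>s\<close> is exactly the one for which the difference
  of these two functions vanishes at \<open>\<eta>\<close>, so this difference is \<open>(z - \<eta>) / D\<close> times a linear
  combination of \<open>1\<close> and \<open>\<sigma>\<close> (\<open>cowen_symbol_factor\<close>). Hence the difference of the operators is
  governed by the functions \<open>(z - \<eta>) * \<sigma> ^ n / D\<close>.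

  The point of tangency makes these functions square-summable. On the unit circle
  \<open>\<bar>D\<bar>\<^sup>2 - \<bar>N\<bar>\<^sup>2\<close> is a nonnegative trigonometric polynomial of degree one with a zero at \<open>\<eta>\<close>, and
  therefore equals \<open>\<kappa> * \<bar>z - \<eta>\<bar>\<^sup>2\<close> for a constant \<open>\<kappa>\<close>, which is positive because \<open>\<phi>\<close> is not an
  automorphism (\<open>moebius_onto_ball\<close>). As an identity of norms,
  \<open>\<parallel>D h\<parallel>\<^sup>2 - \<parallel>N h\<parallel>\<^sup>2 = \<kappa> * \<parallel>(z - \<eta>) h\<parallel>\<^sup>2\<close> for all \<open>h\<close> in the Hardy space
  (\<open>norm_affine_mult_defect\<close>). With \<open>h = \<sigma> ^ n / D\<close> the left-hand side is
  \<open>\<parallel>\<sigma> ^ n\<parallel>\<^sup>2 - \<parallel>\<sigma> ^ (n + 1)\<parallel>\<^sup>2\<close>, so the sum over \<open>n\<close> telescopes and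
  \<open>\<kappa> * (\<Sum>n. \<parallel>(z - \<eta>) * \<sigma> ^ n / D\<parallel>\<^sup>2) \<le> 1\<close>. Thus the difference is even a Hilbert-Schmidt
  operator, and such operators are compact (\<open>hilbert_schmidt_compact\<close>).

  Boundedness of the composition operators comes from the same kind of identity: multiplication by
  \<open>\<phi>\<close> or \<open>\<sigma>\<close> is a contraction, because these maps have modulus at most one on the circle, and
  Horner's scheme then bounds the composition with a polynomial by the coefficients of the polynomial (\<open>norm_horner_hardy\<close>).
  All norms are computed from Taylor coefficients; no boundary integrals occur.
\<close>

section \<open>The Hardy space as a space of square-summable sequences\<close>

lemma taylor_coeff_unique:
  assumes "\<And>z. z \<in> ball 0 1 \<Longrightarrow> (\<lambda>n. u n * z ^ n) sums f z"
  shows "taylor_coeff f n = u n"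
proof -
  have "f has_fps_expansion Abs_fps u"
    by (rule has_fps_expansionI, rule eventually_mono [OF eventually_nhds_in_open [of "ball 0 1"]])
      (use assms in auto)
  from fps_nth_fps_expansion [OF this, of n] show ?thesis
    by (simp add: taylor_coeff_def)
qed

lemma hardy_sums:
  assumes "z \<in> ball 0 1"
  shows "(\<lambda>n. hardy_coeff f n * z ^ n) sums hardy_fun f z"
  using holomorphic_power_series [OF holomorphic_hardy_fun assms]
  by (simp add: hardy_coeff_def taylor_coeff_def)

lemma hardy_fun_outside: "z \<notin> ball 0 1 \<Longrightarrow> hardy_fun f z = 0"
  using hardy_fun [of f] by (simp add: hardy_set_def)

lemma norm_hardy2_sums: "(\<lambda>n. (cmod (hardy_coeff f n))\<^sup>2) sums (norm f)\<^sup>2"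
proof -
  have "(norm f)\<^sup>2 = (\<Sum>n. (cmod (hardy_coeff f n))\<^sup>2)"
    by (simp add: norm_hardy2_def hardy_inner_self suminf_nonneg summable_hardy_coeff)
  then show ?thesis
    using summable_sums [OF summable_hardy_coeff] by simp
qed

lemma sum_hardy_coeff_le_norm: "(\<Sum>n<N. (cmod (hardy_coeff f n))\<^sup>2) \<le> (norm f)\<^sup>2"
  using sum_le_suminf [OF summable_hardy_coeff, of "{..<N}" f] norm_hardy2_sums [of f]
  by (simp add: sums_iff)

lemma norm_hardy_scale: "norm (c *\<^sub>H f) = cmod c * norm f"
proof -
  have "(\<lambda>n. (cmod (hardy_coeff (c *\<^sub>H f) n))\<^sup>2) sums ((cmod c)\<^sup>2 * (norm f)\<^sup>2)"
    using sums_mult [OF norm_hardy2_sums, of "(cmod c)\<^sup>2" f]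
    by (simp add: hardy_coeff_scale norm_mult power_mult_distrib)
  then have "(norm (c *\<^sub>H f))\<^sup>2 = (cmod c * norm f)\<^sup>2"
    unfolding power_mult_distrib by (rule sums_unique2 [OF norm_hardy2_sums])
  then show ?thesis
    by (rule power2_eq_imp_eq) simp_all
qed

lemma hardy_fun_diff: "hardy_fun (f - g) z = hardy_fun f z - hardy_fun g z"
  unfolding minus_hardy2_def hardy_fun_add hardy_fun_scale by simp

lemma hardy_coeff_diff: "hardy_coeff (f - g) n = hardy_coeff f n - hardy_coeff g n"
  unfolding minus_hardy2_def hardy_coeff_add hardy_coeff_scale by simp

lemma hardy_fun_sum: "hardy_fun (sum f A) z = (\<Sum>i\<in>A. hardy_fun (f i) z)"
  by (induction A rule: infinite_finite_induct) (auto simp: hardy_fun_add)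

lemma hardy_coeff_sum: "hardy_coeff (sum f A) n = (\<Sum>i\<in>A. hardy_coeff (f i) n)"
  by (induction A rule: infinite_finite_induct) (auto simp: hardy_coeff_add)

lemma hardy_inner_scale_right: "hardy_inner f (c *\<^sub>H g) = cnj c * hardy_inner f g"
  by (metis complex_cnj_mult hardy_inner_commute hardy_inner_scale_left)

text \<open>Rotating one argument turns the Cauchy-Schwarz inequality of the underlying real inner
  product into the complex one.\<close>

lemma hardy_Cauchy_Schwarz: "cmod (hardy_inner f g) \<le> norm f * norm g"
proof (cases "hardy_inner f g = 0")
  case False
  define c where "c = cnj (sgn (hardy_inner f g))"
  have c: "cmod c = 1"
    using False by (simp add: c_def norm_sgn)
  have "c * hardy_inner f g = of_real (cmod (hardy_inner f g))"
    using False unfolding c_def sgn_eq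
    by (simp add: complex_norm_square [symmetric] mult.commute power2_eq_square)
  then have "cmod (hardy_inner f g) = inner (c *\<^sub>H f) g"
    by (simp add: inner_hardy2_def hardy_inner_scale_left)
  also have "\<dots> \<le> norm (c *\<^sub>H f) * norm g"
    by (rule norm_cauchy_schwarz)
  finally show ?thesis
    by (simp add: norm_hardy_scale c)
qed auto

text \<open>The Hardy space is a copy of the square-summable sequences. Elements are constructed below by
  prescribing their Taylor coefficients, which makes norms and the shift immediate.\<close>

definition hardy_of_coeffs :: "(nat \<Rightarrow> complex) \<Rightarrow> hardy2" where
  "hardy_of_coeffs u = Abs_hardy2 (\<lambda>z. if z \<in> ball 0 1 then \<Sum>n. u n * z ^ n else 0)"

lemma
  assumes "summable (\<lambda>n. (cmod (u n))\<^sup>2)"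
  shows hardy_coeff_of_coeffs: "hardy_coeff (hardy_of_coeffs u) n = u n"
    and hardy_fun_of_coeffs: "z \<in> ball 0 1 \<Longrightarrow> (\<lambda>n. u n * z ^ n) sums hardy_fun (hardy_of_coeffs u) z"
proof -
  define f where "f = (\<lambda>z. if z \<in> ball 0 1 then \<Sum>n. u n * z ^ n else 0)"
  have sums: "(\<lambda>n. u n * z ^ n) sums f z" if z: "z \<in> ball 0 1" for z
  proof -
    have "summable (\<lambda>n. (cmod (u n))\<^sup>2 + ((cmod z)\<^sup>2) ^ n)"
      using z by (intro summable_add [OF assms summable_geometric]) (simp add: abs_square_less_1)
    then have "summable (\<lambda>n. u n * z ^ n)"
    proof (rule summable_comparison_test')
      fix n
      have "2 * (cmod (u n) * cmod z ^ n) \<le> (cmod (u n))\<^sup>2 + ((cmod z)\<^sup>2) ^ n"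
        using sum_squares_bound [of "cmod (u n)" "cmod z ^ n"]
        by (simp add: power_mult [symmetric] mult_ac)
      moreover have "0 \<le> cmod (u n) * cmod z ^ n"
        by simp
      ultimately show "norm (u n * z ^ n) \<le> (cmod (u n))\<^sup>2 + ((cmod z)\<^sup>2) ^ n"
        unfolding norm_mult norm_power by linarith
    qed
    then show ?thesis
      using z by (simp add: f_def summable_sums)
  qed
  have hol: "f holomorphic_on ball 0 1"
    by (rule power_series_holomorphic [where a = u]) (use sums in simp)
  have coeff: "taylor_coeff f n = u n" for n
    by (rule taylor_coeff_unique [OF sums])
  have "f \<in> hardy_set"
    using assms hol by (simp add: hardy_set_def coeff) (simp add: f_def)
  then have hf: "hardy_fun (hardy_of_coeffs u) = f"
    unfolding hardy_of_coeffs_def f_def [symmetric] by (rule Abs_hardy2_inverse)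
  show "hardy_coeff (hardy_of_coeffs u) n = u n"
    by (simp add: hardy_coeff_def hf coeff)
  show "z \<in> ball 0 1 \<Longrightarrow> (\<lambda>n. u n * z ^ n) sums hardy_fun (hardy_of_coeffs u) z"
    using sums by (simp add: hf)
qed

text \<open>Bounds on finitely many coefficients pass to limits; in this form a norm bound survives a limit
  that is only known to exist coefficient by coefficient.\<close>

lemma hardy_set_bounded:
  assumes "f holomorphic_on ball 0 1" "\<And>z. z \<notin> ball 0 1 \<Longrightarrow> f z = 0"
    and "\<And>N. (\<Sum>n<N. (cmod (taylor_coeff f n))\<^sup>2) \<le> M"
  shows "f \<in> hardy_set" "(norm (Abs_hardy2 f))\<^sup>2 \<le> M"
proof -
  have s: "summable (\<lambda>n. (cmod (taylor_coeff f n))\<^sup>2)"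
    by (rule summableI_nonneg_bounded [OF _ assms(3)]) simp
  then show f: "f \<in> hardy_set"
    using assms by (simp add: hardy_set_def)
  have "(norm (Abs_hardy2 f))\<^sup>2 = (\<Sum>n. (cmod (taylor_coeff f n))\<^sup>2)"
    using norm_hardy2_sums [of "Abs_hardy2 f"]
    by (simp add: hardy_coeff_def Abs_hardy2_inverse f sums_iff)
  also have "\<dots> \<le> M"
    by (rule suminf_le_const [OF s assms(3)])
  finally show "(norm (Abs_hardy2 f))\<^sup>2 \<le> M" .
qed

definition monom_hardy :: "nat \<Rightarrow> hardy2" where
  "monom_hardy m = hardy_of_coeffs (\<lambda>n. if n = m then 1 else 0)"

lemma summable_delta: "summable (\<lambda>n. (cmod (if n = m then 1 else 0))\<^sup>2)"
  by (rule summable_finite [of "{m}"]) auto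

lemma hardy_coeff_monom: "hardy_coeff (monom_hardy m) n = (if n = m then 1 else 0)"
  unfolding monom_hardy_def by (rule hardy_coeff_of_coeffs [OF summable_delta])

lemma hardy_fun_monom:
  assumes "z \<in> ball 0 1"
  shows "hardy_fun (monom_hardy m) z = z ^ m"
proof -
  have "(\<lambda>n. (if n = m then 1 else 0) * z ^ n) sums hardy_fun (monom_hardy m) z"
    unfolding monom_hardy_def by (rule hardy_fun_of_coeffs [OF summable_delta assms])
  moreover have "(\<lambda>n. (if n = m then 1 else 0) * z ^ n) = (\<lambda>n. if n = m then z ^ n else 0)"
    by auto
  ultimately show ?thesis
    using sums_unique2 [OF _ sums_single [of m "\<lambda>n. z ^ n"]] by simp
qed

lemma norm_monom_hardy: "norm (monom_hardy m) = 1"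
proof -
  have "(\<lambda>n. (cmod (hardy_coeff (monom_hardy m) n))\<^sup>2) = (\<lambda>n. if n = m then 1 else 0)"
    by (auto simp: hardy_coeff_monom)
  then have "(\<lambda>n. (cmod (hardy_coeff (monom_hardy m) n))\<^sup>2) sums 1"
    using sums_single [of m "\<lambda>n. 1 :: real"] by simp
  then have "(norm (monom_hardy m))\<^sup>2 = 1"
    by (rule sums_unique2 [OF norm_hardy2_sums])
  then show ?thesis
    using norm_ge_zero [of "monom_hardy m"] by (simp add: power2_eq_1_iff)
qed

definition truncate_hardy :: "nat \<Rightarrow> hardy2 \<Rightarrow> hardy2" where
  "truncate_hardy N f = (\<Sum>n<N. hardy_coeff f n *\<^sub>H monom_hardy n)"

lemma hardy_coeff_truncate:
  "hardy_coeff (truncate_hardy N f) n = (if n < N then hardy_coeff f n else 0)"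
proof -
  have "hardy_coeff (truncate_hardy N f) n =
      (\<Sum>m<N. if m = n then hardy_coeff f n else 0)"
    unfolding truncate_hardy_def hardy_coeff_sum hardy_coeff_scale hardy_coeff_monom
    by (intro sum.cong) auto
  then show ?thesis
    by simp
qed

lemma truncate_hardy_tendsto: "(\<lambda>N. truncate_hardy N f) \<longlonglongrightarrow> f"
proof -
  have tail: "(norm (truncate_hardy N f - f))\<^sup>2 =
      (norm f)\<^sup>2 - (\<Sum>n<N. (cmod (hardy_coeff f n))\<^sup>2)" for N
  proof -
    have "(\<lambda>n. (cmod (hardy_coeff f n))\<^sup>2 -
        (if n \<in> {..<N} then (cmod (hardy_coeff f n))\<^sup>2 else 0)) sums
        ((norm f)\<^sup>2 - (\<Sum>n<N. (cmod (hardy_coeff f n))\<^sup>2))"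
      by (intro sums_diff norm_hardy2_sums sums_If_finite_set) simp
    moreover have "(\<lambda>n. (cmod (hardy_coeff f n))\<^sup>2 -
        (if n \<in> {..<N} then (cmod (hardy_coeff f n))\<^sup>2 else 0)) =
        (\<lambda>n. (cmod (hardy_coeff (truncate_hardy N f - f) n))\<^sup>2)"
      by (auto simp: hardy_coeff_diff hardy_coeff_truncate)
    ultimately show ?thesis
      using norm_hardy2_sums [of "truncate_hardy N f - f"] by (metis sums_unique2)
  qed
  have "(\<lambda>N. (norm f)\<^sup>2 - (\<Sum>n<N. (cmod (hardy_coeff f n))\<^sup>2)) \<longlonglongrightarrow> (norm f)\<^sup>2 - (norm f)\<^sup>2"
    using norm_hardy2_sums [of f] unfolding sums_def by (intro tendsto_intros)
  then have "(\<lambda>N. (norm (truncate_hardy N f - f))\<^sup>2) \<longlonglongrightarrow> 0"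
    by (simp add: tail)
  then have "(\<lambda>N. sqrt ((norm (truncate_hardy N f - f))\<^sup>2)) \<longlonglongrightarrow> sqrt 0"
    by (intro tendsto_intros)
  then show ?thesis
    by (simp add: LIM_zero_iff tendsto_norm_zero_iff)
qed

text \<open>The reproducing kernel at \<open>w\<close>, that is, the function \<open>z \<mapsto> 1 / (1 - cnj w * z)\<close>.\<close>

definition kernel_hardy :: "complex \<Rightarrow> hardy2" where
  "kernel_hardy w = hardy_of_coeffs (\<lambda>n. cnj w ^ n)"

lemma kernel_coeff_sums:
  assumes "w \<in> ball 0 1"
  shows "(\<lambda>n. (cmod (cnj w ^ n))\<^sup>2) sums (1 / (1 - (cmod w)\<^sup>2))"
  using geometric_sums [of "(cmod w)\<^sup>2"] assms
  by (simp add: norm_power power_mult [symmetric] mult.commute abs_square_less_1)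

lemma hardy_coeff_kernel: "w \<in> ball 0 1 \<Longrightarrow> hardy_coeff (kernel_hardy w) n = cnj w ^ n"
  unfolding kernel_hardy_def
  by (rule hardy_coeff_of_coeffs) (use kernel_coeff_sums sums_summable in blast)

lemma hardy_fun_kernel:
  assumes "w \<in> ball 0 1" "z \<in> ball 0 1"
  shows "hardy_fun (kernel_hardy w) z = 1 / (1 - cnj w * z)"
proof -
  have "cmod (cnj w * z) < 1"
    using assms mult_strict_mono' [of "cmod w" 1 "cmod z" 1] by (simp add: norm_mult)
  then have "(\<lambda>n. cnj w ^ n * z ^ n) sums (1 / (1 - cnj w * z))"
    using geometric_sums [of "cnj w * z"] by (simp add: power_mult_distrib)
  then show ?thesis
    using hardy_sums [OF assms(2), of "kernel_hardy w"]
    unfolding hardy_coeff_kernel [OF assms(1)] by (rule sums_unique2 [symmetric])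
qed

lemma norm_kernel_hardy:
  assumes "w \<in> ball 0 1"
  shows "(norm (kernel_hardy w))\<^sup>2 = 1 / (1 - (cmod w)\<^sup>2)"
  using norm_hardy2_sums [of "kernel_hardy w"] kernel_coeff_sums [OF assms]
  unfolding hardy_coeff_kernel [OF assms] by (rule sums_unique2)

lemma hardy_inner_kernel:
  assumes "w \<in> ball 0 1"
  shows "hardy_inner f (kernel_hardy w) = hardy_fun f w"
  using hardy_sums [OF assms, of f]
  by (simp add: hardy_inner_def hardy_coeff_kernel [OF assms] sums_iff)

lemma hardy_inner_monom: "hardy_inner f (monom_hardy m) = hardy_coeff f m"
proof -
  have "(\<lambda>n. if n = m then hardy_coeff f n else 0) sums hardy_coeff f m"
    by (rule sums_single)
  moreover have "(\<lambda>n. if n = m then hardy_coeff f n else 0) =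
      (\<lambda>n. hardy_coeff f n * cnj (hardy_coeff (monom_hardy m) n))"
    by (auto simp: hardy_coeff_monom)
  ultimately show ?thesis
    by (simp add: hardy_inner_def sums_iff)
qed

lemma hardy_coeff_0: "hardy_coeff f 0 = hardy_fun f 0"
  by (simp add: hardy_coeff_def taylor_coeff_def)

section \<open>The shift and multiplication by rational functions of degree one\<close>

definition shift_hardy :: "hardy2 \<Rightarrow> hardy2" where
  "shift_hardy f = hardy_of_coeffs (case_nat 0 (hardy_coeff f))"

definition backshift_hardy :: "hardy2 \<Rightarrow> hardy2" where
  "backshift_hardy f = hardy_of_coeffs (\<lambda>n. hardy_coeff f (Suc n))"

lemma summable_case_nat: "summable (\<lambda>n. (cmod (case_nat 0 (hardy_coeff f) n))\<^sup>2)"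
  by (subst summable_Suc_iff [symmetric]) (simp add: summable_hardy_coeff)

lemma hardy_coeff_shift: "hardy_coeff (shift_hardy f) n = case_nat 0 (hardy_coeff f) n"
  unfolding shift_hardy_def by (rule hardy_coeff_of_coeffs [OF summable_case_nat])

lemma hardy_coeff_backshift: "hardy_coeff (backshift_hardy f) n = hardy_coeff f (Suc n)"
  unfolding backshift_hardy_def
  by (rule hardy_coeff_of_coeffs)
    (simp add: summable_Suc_iff [of "\<lambda>n. (cmod (hardy_coeff f n))\<^sup>2"] summable_hardy_coeff)

lemma hardy_fun_shift: "hardy_fun (shift_hardy f) z = z * hardy_fun f z"
proof (cases "z \<in> ball 0 1")
  case True
  have "(\<lambda>n. hardy_coeff (shift_hardy f) (Suc n) * z ^ Suc n) sums (z * hardy_fun f z)"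
    using sums_mult [OF hardy_sums [OF True, of f], of z]
    by (simp add: hardy_coeff_shift mult_ac)
  then have "(\<lambda>n. hardy_coeff (shift_hardy f) n * z ^ n) sums (z * hardy_fun f z)"
    by (rule sums_Suc_imp [rotated]) (simp add: hardy_coeff_shift)
  then show ?thesis
    by (rule sums_unique2 [OF hardy_sums [OF True]])
qed (simp add: hardy_fun_outside)

lemma norm_shift_hardy: "norm (shift_hardy f) = norm f"
proof -
  have "(\<lambda>n. (cmod (hardy_coeff (shift_hardy f) n))\<^sup>2) sums (norm f)\<^sup>2"
    by (rule sums_Suc_imp) (simp_all add: hardy_coeff_shift norm_hardy2_sums)
  then have "(norm (shift_hardy f))\<^sup>2 = (norm f)\<^sup>2"
    by (rule sums_unique2 [OF norm_hardy2_sums])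
  then show ?thesis
    by (rule power2_eq_imp_eq) simp_all
qed

lemma norm_backshift_le: "norm (backshift_hardy f) \<le> norm f"
proof -
  have "(\<lambda>n. (cmod (hardy_coeff f (Suc n)))\<^sup>2) sums ((norm f)\<^sup>2 - (cmod (hardy_coeff f 0))\<^sup>2)"
    by (subst sums_Suc_iff) (simp add: norm_hardy2_sums)
  then have "(norm (backshift_hardy f))\<^sup>2 = (norm f)\<^sup>2 - (cmod (hardy_coeff f 0))\<^sup>2"
    using sums_unique2 [OF norm_hardy2_sums [of "backshift_hardy f"]]
    by (simp add: hardy_coeff_backshift)
  then have "(norm (backshift_hardy f))\<^sup>2 \<le> (norm f)\<^sup>2"
    by simp
  then show ?thesis
    by (rule power2_le_imp_le) simp
qed

lemma hardy_inner_backshift: "hardy_inner (backshift_hardy f) g = hardy_inner f (shift_hardy g)"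
proof -
  have "(\<lambda>n. hardy_coeff f n * cnj (hardy_coeff (shift_hardy g) n)) sums
      hardy_inner (backshift_hardy f) g"
    by (rule sums_Suc_imp)
      (use summable_sums [OF summable_hardy_inner [of "backshift_hardy f" g]] in
        \<open>simp_all add: hardy_coeff_shift hardy_coeff_backshift hardy_inner_def\<close>)
  then show ?thesis
    by (simp add: hardy_inner_def [of f] sums_iff)
qed

definition affine_mult :: "complex \<Rightarrow> complex \<Rightarrow> hardy2 \<Rightarrow> hardy2" where
  "affine_mult a b f = a *\<^sub>H shift_hardy f + b *\<^sub>H f"

lemma hardy_fun_affine_mult: "hardy_fun (affine_mult a b f) z = (a * z + b) * hardy_fun f z"
  by (simp add: affine_mult_def hardy_fun_add hardy_fun_scale hardy_fun_shift algebra_simps)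

lemma norm_affine_mult:
  "(norm (affine_mult a b f))\<^sup>2 =
     ((cmod a)\<^sup>2 + (cmod b)\<^sup>2) * (norm f)\<^sup>2 + 2 * Re (a * cnj b * hardy_inner (shift_hardy f) f)"
proof -
  have "(norm (affine_mult a b f))\<^sup>2 = (norm (a *\<^sub>H shift_hardy f))\<^sup>2 + (norm (b *\<^sub>H f))\<^sup>2 +
      2 * inner (a *\<^sub>H shift_hardy f) (b *\<^sub>H f)"
    unfolding affine_mult_def power2_norm_eq_inner
    by (simp add: inner_add_left inner_add_right inner_commute)
  then show ?thesis
    by (simp add: norm_hardy_scale norm_shift_hardy power_mult_distrib algebra_simps
        inner_hardy2_def hardy_inner_scale_left hardy_inner_scale_right)
qed

text \<open>The coefficients of \<open>f z / (1 - q * z)\<close>, where \<open>u\<close> are the coefficients of \<open>f\<close>.\<close>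

primrec geometric_conv :: "complex \<Rightarrow> (nat \<Rightarrow> complex) \<Rightarrow> nat \<Rightarrow> complex" where
  "geometric_conv q u 0 = u 0"
| "geometric_conv q u (Suc n) = q * geometric_conv q u n + u (Suc n)"

text \<open>Division by \<open>c * z + d\<close>. For \<open>cmod c < cmod d\<close> the quotient \<open>- c / d\<close> has modulus less than one,
  and \<open>1 / (c * z + d)\<close> is \<open>1 / d\<close> times a geometric series.\<close>

definition affine_div :: "complex \<Rightarrow> complex \<Rightarrow> hardy2 \<Rightarrow> hardy2" where
  "affine_div c d f = (1 / d) *\<^sub>H hardy_of_coeffs (geometric_conv (- c / d) (hardy_coeff f))"

lemma affine_nonzero:
  fixes c d z :: complex
  assumes "cmod c < cmod d" "z \<in> cball 0 1"
  shows "c * z + d \<noteq> 0"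
proof
  assume "c * z + d = 0"
  then have "cmod d = cmod (c * z)"
    by (metis add_eq_0_iff norm_minus_cancel)
  then show False
    using assms mult_left_mono [of "cmod z" 1 "cmod c"] by (simp add: norm_mult)
qed

text \<open>The convolution \<open>h\<close> satisfies \<open>h = q * (shift of h) + u\<close>, and the shift does not increase the
  norm of a truncated sequence. The triangle inequality gives \<open>\<parallel>h\<parallel> \<le> cmod q * \<parallel>h\<parallel> + \<parallel>u\<parallel>\<close> for the
  truncations, where all terms are finite.\<close>

lemma geometric_conv_bound:
  assumes q: "cmod q < 1"
  shows "(\<Sum>n<N. (cmod (geometric_conv q u n))\<^sup>2) \<le> (\<Sum>n<N. (cmod (u n))\<^sup>2) / (1 - cmod q)\<^sup>2"
proof -
  define h where "h = geometric_conv q u"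
  define r where "r = L2_set (\<lambda>n. cmod (h n)) {..<N}"
  have shift: "L2_set (\<lambda>n. cmod (case_nat 0 h n)) {..<N} \<le> r"
  proof (cases N)
    case (Suc M)
    have "(\<Sum>n<Suc M. (cmod (case_nat 0 h n))\<^sup>2) = (\<Sum>n<M. (cmod (h n))\<^sup>2)"
      by (subst sum.lessThan_Suc_shift) simp
    also have "\<dots> \<le> (\<Sum>n<Suc M. (cmod (h n))\<^sup>2)"
      by simp
    finally show ?thesis
      by (simp add: r_def L2_set_def Suc)
  qed (simp add: r_def L2_set_def)
  have rec: "h n = q * case_nat 0 h n + u n" for n
    by (cases n) (simp_all add: h_def)
  have "cmod (h n) \<le> cmod q * cmod (case_nat 0 h n) + cmod (u n)" for n
    using norm_triangle_ineq [of "q * case_nat 0 h n" "u n"] by (simp add: rec [of n] norm_mult)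
  then have "r \<le> L2_set (\<lambda>n. cmod q * cmod (case_nat 0 h n) + cmod (u n)) {..<N}"
    unfolding r_def by (intro L2_set_mono) auto
  also have "\<dots> \<le> L2_set (\<lambda>n. cmod q * cmod (case_nat 0 h n)) {..<N} + L2_set (\<lambda>n. cmod (u n)) {..<N}"
    by (rule L2_set_triangle_ineq)
  also have "L2_set (\<lambda>n. cmod q * cmod (case_nat 0 h n)) {..<N} \<le> cmod q * r"
    using shift by (simp add: L2_set_right_distrib [symmetric] mult_left_mono)
  finally have "(1 - cmod q) * r \<le> L2_set (\<lambda>n. cmod (u n)) {..<N}"
    by (simp add: algebra_simps)
  then have "((1 - cmod q) * r)\<^sup>2 \<le> (L2_set (\<lambda>n. cmod (u n)) {..<N})\<^sup>2"
    using q by (intro power_mono) (auto simp: r_def L2_set_nonneg)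
  then have "(1 - cmod q)\<^sup>2 * (\<Sum>n<N. (cmod (h n))\<^sup>2) \<le> (\<Sum>n<N. (cmod (u n))\<^sup>2)"
    unfolding power_mult_distrib by (simp add: r_def L2_set_def sum_nonneg)
  then show ?thesis
    using q by (simp add: h_def pos_le_divide_eq mult.commute)
qed

lemma
  assumes cd: "cmod c < cmod d"
  shows hardy_fun_affine_div: "z \<in> cball 0 1 \<Longrightarrow> hardy_fun (affine_div c d f) z = hardy_fun f z / (c * z + d)"
    and norm_affine_div_le: "norm (affine_div c d f) \<le> norm f / (cmod d - cmod c)"
proof -
  define q where "q = - c / d"
  define h where "h = geometric_conv q (hardy_coeff f)"
  have d: "d \<noteq> 0"
    using cd by auto
  have q: "cmod q < 1"
    using cd d by (simp add: q_def norm_divide)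
  have le: "(\<Sum>n<N. (cmod (h n))\<^sup>2) \<le> (norm f / (1 - cmod q))\<^sup>2" for N
    unfolding h_def power_divide
    by (rule order_trans [OF geometric_conv_bound [OF q] divide_right_mono])
      (simp_all add: sum_hardy_coeff_le_norm)
  have s: "summable (\<lambda>n. (cmod (h n))\<^sup>2)"
    by (rule summableI_nonneg_bounded [OF _ le]) simp
  define g where "g = hardy_of_coeffs h"
  have g: "hardy_coeff g n = h n" for n
    by (simp add: g_def hardy_coeff_of_coeffs s)
  have ad: "affine_div c d f = (1 / d) *\<^sub>H g"
    by (simp add: affine_div_def g_def h_def q_def)
  have "affine_mult (- q) 1 g = f"
  proof (rule hardy2_eqI_coeff)
    show "hardy_coeff (affine_mult (- q) 1 g) n = hardy_coeff f n" for n
      by (cases n) (simp_all add: affine_mult_def hardy_coeff_add hardy_coeff_diff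
          hardy_coeff_scale hardy_coeff_shift g h_def)
  qed
  then have eq: "(- q * z + 1) * hardy_fun g z = hardy_fun f z" for z
    by (metis hardy_fun_affine_mult)
  show "hardy_fun (affine_div c d f) z = hardy_fun f z / (c * z + d)" if "z \<in> cball 0 1"
  proof -
    have "c * z + d \<noteq> 0"
      by (rule affine_nonzero [OF cd that])
    moreover have "c * z + d = d * (- q * z + 1)"
      using d by (simp add: q_def field_simps)
    ultimately show ?thesis
      using d by (simp add: ad hardy_fun_scale eq [symmetric])
  qed
  have "(norm g)\<^sup>2 \<le> (norm f / (1 - cmod q))\<^sup>2"
    using suminf_le_const [OF s le] norm_hardy2_sums [of g] by (simp add: g sums_iff)
  then have "norm g \<le> norm f / (1 - cmod q)"
    using q power2_le_imp_le [of "norm g" "norm f / (1 - cmod q)"] by simp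
  then have "norm (affine_div c d f) \<le> norm f / (1 - cmod q) / cmod d"
    using divide_right_mono [of "norm g" "norm f / (1 - cmod q)" "cmod d"]
    by (simp add: ad norm_hardy_scale norm_divide)
  also have "\<dots> = norm f / (cmod d - cmod c)"
  proof -
    have "(1 - cmod q) * cmod d = cmod d - cmod c"
      using d by (simp add: q_def norm_divide left_diff_distrib)
    then show ?thesis
      by simp
  qed
  finally show "norm (affine_div c d f) \<le> norm f / (cmod d - cmod c)" .
qed

section \<open>Littlewood's theorem for linear-fractional maps\<close>

lemma cmod_affine_sq:
  "(cmod (a * z + b))\<^sup>2 = (cmod a)\<^sup>2 * (cmod z)\<^sup>2 + (cmod b)\<^sup>2 + 2 * Re (a * cnj b * z)"
proof -
  have "(cmod (a * z + b))\<^sup>2 = (cmod (a * z))\<^sup>2 + (cmod b)\<^sup>2 + 2 * Re (a * z * cnj b)"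
    by (simp only: cmod_power2 plus_complex.sel complex_cnj times_complex.sel) (simp add: power2_eq_square algebra_simps)
  then show ?thesis
    by (simp add: norm_mult power_mult_distrib mult_ac)
qed

text \<open>The minimum of \<open>A + 2 * Re (B * z)\<close> on the unit circle is \<open>A - 2 * cmod B\<close>.\<close>

lemma circle_trig_nonneg:
  assumes "\<And>z. cmod z = 1 \<Longrightarrow> 0 \<le> A + 2 * Re (B * z)"
  shows "2 * cmod B \<le> A"
proof (cases "B = 0")
  case True
  then show ?thesis
    using assms [of 1] by simp
next
  case False
  have "B * - cnj (sgn B) = - of_real (cmod B)"
    using False unfolding sgn_eq
    by (simp add: complex_norm_square [symmetric] mult.commute power2_eq_square)
  then have "Re (B * - cnj (sgn B)) = - cmod B"
    by simp
  then show ?thesis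
    using assms [of "- cnj (sgn B)"] False by (simp add: norm_sgn)
qed

text \<open>If the minimum is zero, it is a double zero: the conclusion says that the trigonometric
  polynomial is \<open>cmod B * (cmod (z - \<eta>))\<^sup>2\<close> on the circle.\<close>

lemma circle_trig_zero:
  assumes nonneg: "\<And>z. cmod z = 1 \<Longrightarrow> 0 \<le> A + 2 * Re (B * z)"
    and \<eta>: "cmod \<eta> = 1" "A + 2 * Re (B * \<eta>) = 0"
  shows "A = 2 * cmod B" "B = - of_real (cmod B) * cnj \<eta>"
proof -
  have "2 * cmod B \<le> A"
    by (rule circle_trig_nonneg [OF nonneg])
  moreover have "\<bar>Re (B * \<eta>)\<bar> \<le> cmod B"
    using abs_Re_le_cmod [of "B * \<eta>"] \<eta> by (simp add: norm_mult)
  ultimately have Re: "Re (B * \<eta>) = - cmod B" and A: "A = 2 * cmod B"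
    using \<eta>(2) by linarith+
  show "A = 2 * cmod B"
    by (rule A)
  have "(cmod B)\<^sup>2 = (Re (B * \<eta>))\<^sup>2 + (Im (B * \<eta>))\<^sup>2"
    by (simp only: cmod_power2 [symmetric]) (simp add: norm_mult \<eta>)
  then have "(Im (B * \<eta>))\<^sup>2 = 0"
    unfolding Re by simp
  then have "B * \<eta> = - of_real (cmod B)"
    using Re by (simp add: complex_eq_iff del: times_complex.sel)
  then have "B * \<eta> * cnj \<eta> = - of_real (cmod B) * cnj \<eta>"
    by simp
  then show "B = - of_real (cmod B) * cnj \<eta>"
    using \<eta>(1) complex_norm_square [of \<eta>] by (simp add: mult.assoc)
qed

text \<open>An inequality between affine functions on the circle passes to the multiplication operators:
  the difference of the squared norms is \<open>A * (norm f)\<^sup>2 + 2 * Re (B * v)\<close> with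
  \<open>v = hardy_inner (shift_hardy f) f\<close>, where \<open>cmod v \<le> (norm f)\<^sup>2\<close>, and the hypothesis is
  \<open>A + 2 * Re (B * z) \<ge> 0\<close> on the circle.\<close>

lemma norm_affine_mult_mono:
  assumes "\<And>z. cmod z = 1 \<Longrightarrow> cmod (a * z + b) \<le> cmod (c * z + d)"
  shows "norm (affine_mult a b f) \<le> norm (affine_mult c d f)"
proof -
  define A B where "A = (cmod c)\<^sup>2 + (cmod d)\<^sup>2 - ((cmod a)\<^sup>2 + (cmod b)\<^sup>2)"
    and "B = c * cnj d - a * cnj b"
  define v where "v = hardy_inner (shift_hardy f) f"
  have "2 * cmod B \<le> A"
  proof (rule circle_trig_nonneg)
    fix z :: complex
    assume "cmod z = 1"
    then have "(cmod (a * z + b))\<^sup>2 \<le> (cmod (c * z + d))\<^sup>2"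
      using assms by (intro power_mono) auto
    then show "0 \<le> A + 2 * Re (B * z)"
      unfolding cmod_affine_sq using \<open>cmod z = 1\<close> by (simp add: A_def B_def algebra_simps)
  qed
  then have "2 * cmod B * (norm f)\<^sup>2 \<le> A * (norm f)\<^sup>2"
    by (rule mult_right_mono) simp
  moreover have "\<bar>Re (B * v)\<bar> \<le> cmod B * (norm f)\<^sup>2"
  proof -
    have "cmod v \<le> (norm f)\<^sup>2"
      using hardy_Cauchy_Schwarz [of "shift_hardy f" f]
      by (simp add: v_def norm_shift_hardy power2_eq_square)
    then show ?thesis
      using abs_Re_le_cmod [of "B * v"] mult_left_mono [of "cmod v" "(norm f)\<^sup>2" "cmod B"]
      by (simp add: norm_mult)
  qed
  ultimately have "0 \<le> A * (norm f)\<^sup>2 + 2 * Re (B * v)"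
    by linarith
  then have "(norm (affine_mult a b f))\<^sup>2 \<le> (norm (affine_mult c d f))\<^sup>2"
    by (simp add: norm_affine_mult A_def B_def v_def algebra_simps)
  then show ?thesis
    by (rule power2_le_imp_le) simp
qed

text \<open>Horner's scheme for the composition of a polynomial with a function \<open>\<psi>\<close>, given \<open>M\<close> as
  multiplication by \<open>\<psi>\<close>; the monomial of degree \<open>0\<close> is the constant function \<open>1\<close>.\<close>

primrec horner_hardy :: "(hardy2 \<Rightarrow> hardy2) \<Rightarrow> complex list \<Rightarrow> hardy2" where
  "horner_hardy M [] = 0"
| "horner_hardy M (x # xs) = x *\<^sub>H monom_hardy 0 + M (horner_hardy M xs)"

lemma hardy_fun_horner:
  assumes "\<And>g. hardy_fun (M g) z = w * hardy_fun g z" "z \<in> ball 0 1"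
  shows "hardy_fun (horner_hardy M xs) z = (\<Sum>k<length xs. xs ! k * w ^ k)"
proof (induction xs)
  case (Cons x xs)
  then show ?case
    by (simp add: hardy_fun_add hardy_fun_scale hardy_fun_monom [OF assms(2)] assms(1)
        sum.lessThan_Suc_shift sum_distrib_left mult_ac del: sum.lessThan_Suc)
qed simp

text \<open>The scalar estimate behind a Horner step. The cross terms, of size
  \<open>4 * cmod p * cmod x * cmod v\<close> in total, are split by the inequality between the arithmetic and the geometric mean with
  weight \<open>1 - (cmod p)\<^sup>2\<close>.\<close>

lemma horner_step_ineq:
  fixes x p v :: complex
  assumes "cmod p < 1"
  shows "(cmod x)\<^sup>2 + 2 * Re (cnj x * (p * v)) + (cmod (x + p * v))\<^sup>2
    \<le> (2 + 4 * (cmod p)\<^sup>2 / (1 - (cmod p)\<^sup>2)) * (cmod x)\<^sup>2 + (cmod v)\<^sup>2"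
proof -
  define t where "t = 1 - (cmod p)\<^sup>2"
  have t: "t > 0"
    using assms by (simp add: t_def abs_square_less_1)
  have cross: "4 * (cmod p * cmod x * cmod v) \<le> 4 * (cmod p)\<^sup>2 / t * (cmod x)\<^sup>2 + t * (cmod v)\<^sup>2"
  proof -
    have "0 \<le> (2 * cmod p * cmod x - t * cmod v)\<^sup>2 / t"
      using t by simp
    also have "\<dots> = 4 * (cmod p)\<^sup>2 / t * (cmod x)\<^sup>2 - 4 * (cmod p * cmod x * cmod v) + t * (cmod v)\<^sup>2"
      using t by (simp add: power2_eq_square field_simps)
    finally show ?thesis
      by simp
  qed
  have "Re (cnj x * (p * v)) \<le> cmod p * cmod x * cmod v"
    using complex_Re_le_cmod [of "cnj x * (p * v)"] by (simp add: norm_mult mult_ac)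
  moreover have "(cmod (x + p * v))\<^sup>2 = (cmod p)\<^sup>2 * (cmod v)\<^sup>2 + (cmod x)\<^sup>2 + 2 * Re (cnj x * (p * v))"
    using cmod_affine_sq [of p v x] by (simp add: add.commute mult_ac)
  ultimately show ?thesis
    using cross by (simp add: t_def algebra_simps)
qed

lemma norm_const_plus_sq:
  "(norm (x *\<^sub>H monom_hardy 0 + g))\<^sup>2 = (cmod x)\<^sup>2 + 2 * Re (cnj x * hardy_fun g 0) + (norm g)\<^sup>2"
proof -
  have "inner g (x *\<^sub>H monom_hardy 0) = Re (cnj x * hardy_fun g 0)"
    by (simp add: inner_hardy2_def hardy_inner_scale_right hardy_inner_monom hardy_coeff_0)
  moreover have "(norm (x *\<^sub>H monom_hardy 0 + g))\<^sup>2 =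
      (norm (x *\<^sub>H monom_hardy 0))\<^sup>2 + 2 * inner g (x *\<^sub>H monom_hardy 0) + (norm g)\<^sup>2"
    unfolding power2_norm_eq_inner by (simp add: inner_add_left inner_add_right inner_commute)
  ultimately show ?thesis
    by (simp add: norm_hardy_scale norm_monom_hardy)
qed

text \<open>One Horner step passes from \<open>g\<close> to \<open>x + M g\<close>, and the squared norm grows by at most
  \<open>(cmod x)\<^sup>2\<close> and a cross term \<open>2 * Re (cnj x * p * g 0)\<close>, where \<open>p = \<psi> 0\<close>. The cross term cannot
  be absorbed into \<open>(norm g)\<^sup>2\<close>: a factor above \<open>1\<close> there would be compounded at every step. The induction therefore carries
  along \<open>(cmod (g 0))\<^sup>2\<close> as well: since the value at \<open>0\<close> becomes \<open>x + p * g 0\<close> with \<open>cmod p < 1\<close>,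
  the loss \<open>(1 - (cmod p)\<^sup>2) * (cmod (g 0))\<^sup>2\<close> in this term pays for the cross term.\<close>

lemma norm_horner_hardy:
  assumes contraction: "\<And>g. norm (M g) \<le> norm g"
    and at_0: "\<And>g. hardy_fun (M g) 0 = p * hardy_fun g 0" and p: "cmod p < 1"
  shows "(norm (horner_hardy M xs))\<^sup>2 + (cmod (hardy_fun (horner_hardy M xs) 0))\<^sup>2
    \<le> (2 + 4 * (cmod p)\<^sup>2 / (1 - (cmod p)\<^sup>2)) * (\<Sum>k<length xs. (cmod (xs ! k))\<^sup>2)"
proof (induction xs)
  case (Cons x xs)
  define g where "g = horner_hardy M xs"
  define L where "L = 2 + 4 * (cmod p)\<^sup>2 / (1 - (cmod p)\<^sup>2)"
  have "(norm (M g))\<^sup>2 \<le> (norm g)\<^sup>2"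
    by (rule power_mono [OF contraction norm_ge_zero])
  then have "(norm (horner_hardy M (x # xs)))\<^sup>2 + (cmod (hardy_fun (horner_hardy M (x # xs)) 0))\<^sup>2
      \<le> (cmod x)\<^sup>2 + 2 * Re (cnj x * (p * hardy_fun g 0)) + (cmod (x + p * hardy_fun g 0))\<^sup>2 + (norm g)\<^sup>2"
    by (simp add: norm_const_plus_sq g_def [symmetric] at_0 hardy_fun_add hardy_fun_scale hardy_fun_monom)
  also have "\<dots> \<le> L * (cmod x)\<^sup>2 + ((norm g)\<^sup>2 + (cmod (hardy_fun g 0))\<^sup>2)"
    using horner_step_ineq [OF p, of x "hardy_fun g 0"] unfolding L_def by linarith
  also have "\<dots> \<le> L * (cmod x)\<^sup>2 + L * (\<Sum>k<length xs. (cmod (xs ! k))\<^sup>2)"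
    using Cons.IH unfolding g_def L_def by linarith
  also have "\<dots> = L * (\<Sum>k<length (x # xs). (cmod ((x # xs) ! k))\<^sup>2)"
    by (simp add: sum.lessThan_Suc_shift distrib_left del: sum.lessThan_Suc)
  finally show ?case
    unfolding L_def .
qed simp

text \<open>A condition on the coefficients under which \<open>moebius a b c d\<close> is analytic on the closed disk and maps the
  open disk into itself. The quotient is avoided, so the convention \<open>x / 0 = 0\<close> is irrelevant.\<close>

definition disk_map :: "complex \<Rightarrow> complex \<Rightarrow> complex \<Rightarrow> complex \<Rightarrow> bool" where
  "disk_map a b c d \<longleftrightarrow>
     cmod c < cmod d \<and> (\<forall>z\<in>ball 0 1. cmod (a * z + b) < cmod (c * z + d))"

lemma cmod_le_cball:
  assumes "\<And>z. z \<in> ball 0 1 \<Longrightarrow> cmod (a * z + b) \<le> cmod (c * z + d)" "z \<in> cball 0 1"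
  shows "cmod (a * z + b) \<le> cmod (c * z + d)"
proof -
  have "closed {z. cmod (a * z + b) \<le> cmod (c * z + d)}"
    by (intro closed_Collect_le continuous_intros)
  then have "closure (ball 0 1) \<subseteq> {z. cmod (a * z + b) \<le> cmod (c * z + d)}"
    using assms(1) by (intro closure_minimal) auto
  then show ?thesis
    using assms(2) by auto
qed

lemma moebius_in_ball:
  assumes "disk_map a b c d" "z \<in> ball 0 1"
  shows "moebius a b c d z \<in> ball 0 1"
proof -
  have "cmod (a * z + b) < cmod (c * z + d)"
    using assms by (auto simp: disk_map_def)
  moreover from this have "0 < cmod (c * z + d)"
    by (rule le_less_trans [OF norm_ge_zero])
  ultimately show ?thesis
    by (simp add: moebius_def norm_divide divide_less_eq_1_pos)
qed

lemma affine_mult_div: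
  assumes "cmod c < cmod d"
  shows "affine_mult c d (affine_div c d g) = g"
proof (rule hardy2_eqI)
  show "hardy_fun (affine_mult c d (affine_div c d g)) z = hardy_fun g z" for z
    using affine_nonzero [OF assms, of z]
    by (cases "z \<in> ball 0 1")
      (simp_all add: hardy_fun_affine_mult hardy_fun_affine_div [OF assms] hardy_fun_outside)
qed

lemma
  assumes "disk_map a b c d"
  shows norm_moebius_mult_le: "norm (affine_mult a b (affine_div c d g)) \<le> norm g"
    and hardy_fun_moebius_mult: "z \<in> ball 0 1 \<Longrightarrow>
      hardy_fun (affine_mult a b (affine_div c d g)) z = moebius a b c d z * hardy_fun g z"
proof -
  have cd: "cmod c < cmod d"
    using assms by (simp add: disk_map_def)
  have "norm (affine_mult a b (affine_div c d g)) \<le> norm (affine_mult c d (affine_div c d g))"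
  proof (rule norm_affine_mult_mono)
    show "cmod (a * z + b) \<le> cmod (c * z + d)" if "cmod z = 1" for z
      by (rule cmod_le_cball) (use assms that in \<open>auto simp: disk_map_def less_imp_le\<close>)
  qed
  then show "norm (affine_mult a b (affine_div c d g)) \<le> norm g"
    by (simp only: affine_mult_div [OF cd])
  show "hardy_fun (affine_mult a b (affine_div c d g)) z = moebius a b c d z * hardy_fun g z"
    if "z \<in> ball 0 1"
    using that by (simp add: hardy_fun_affine_mult hardy_fun_affine_div [OF cd] moebius_def)
qed

text \<open>Norm convergence implies uniform convergence on compact subsets of the disk.\<close>

lemma hardy_fun_diff_le:
  assumes "w \<in> ball 0 1"
  shows "cmod (hardy_fun f w - hardy_fun g w) \<le> norm (f - g) / sqrt (1 - (cmod w)\<^sup>2)"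
proof -
  have "norm (kernel_hardy w) = 1 / sqrt (1 - (cmod w)\<^sup>2)"
    using arg_cong [OF norm_kernel_hardy [OF assms], of sqrt] by (simp add: real_sqrt_divide)
  then show ?thesis
    using hardy_Cauchy_Schwarz [of "f - g" "kernel_hardy w"]
    by (simp add: hardy_inner_kernel [OF assms] hardy_fun_diff)
qed

text \<open>Littlewood's subordination theorem for \<open>\<psi> = moebius a b c d\<close>. Horner's scheme bounds
  \<open>f \<circ> \<psi>\<close> for the Taylor polynomials of \<open>f\<close>. These converge to \<open>f \<circ> \<psi>\<close> uniformly near \<open>0\<close>, hence so do
  their Taylor coefficients, and the bound survives in the limit coefficient by coefficient.\<close>

lemma
  assumes dm: "disk_map a b c d"
  defines "L \<equiv> 2 + 4 * (cmod (b / d))\<^sup>2 / (1 - (cmod (b / d))\<^sup>2)"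
  shows hardy_fun_composition: "z \<in> ball 0 1 \<Longrightarrow>
      hardy_fun (composition_operator (moebius a b c d) f) z = hardy_fun f (moebius a b c d z)"
    and norm_composition_sq_le:
      "(norm (composition_operator (moebius a b c d) f))\<^sup>2 \<le> L * (norm f)\<^sup>2"
proof -
  define \<psi> where "\<psi> = moebius a b c d"
  define M where "M = (\<lambda>g. affine_mult a b (affine_div c d g))"
  define T where "T = (\<lambda>n. horner_hardy M (map (hardy_coeff f) [0..<n]))"
  define g where "g = (\<lambda>z. if z \<in> ball 0 1 then hardy_fun f (\<psi> z) else 0)"
  have cd: "cmod c < cmod d"
    using dm by (simp add: disk_map_def)
  have \<psi>_ball: "\<psi> z \<in> ball 0 1" if "z \<in> ball 0 1" for z
    unfolding \<psi>_def by (rule moebius_in_ball [OF dm that])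
  have \<psi>_hol: "\<psi> holomorphic_on ball 0 1"
    unfolding \<psi>_def moebius_def
    by (intro holomorphic_intros) (use affine_nonzero [OF cd] in auto)
  have p: "cmod (b / d) < 1"
    using \<psi>_ball [of 0] by (simp add: \<psi>_def moebius_def)
  have T_eq: "hardy_fun (T n) z = hardy_fun (truncate_hardy n f) (\<psi> z)" if z: "z \<in> ball 0 1" for n z
  proof -
    have "hardy_fun (T n) z = (\<Sum>k<n. hardy_coeff f k * \<psi> z ^ k)"
      unfolding T_def
      by (subst hardy_fun_horner [where w = "\<psi> z"])
        (use z in \<open>simp_all add: M_def \<psi>_def hardy_fun_moebius_mult [OF dm]\<close>)
    also have "\<dots> = hardy_fun (truncate_hardy n f) (\<psi> z)"
      unfolding truncate_hardy_def hardy_fun_sum hardy_fun_scale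
      by (simp add: hardy_fun_monom [OF \<psi>_ball [OF z]])
    finally show ?thesis .
  qed
  have T_norm: "(norm (T n))\<^sup>2 \<le> L * (norm f)\<^sup>2" for n
  proof -
    have contraction: "norm (M g) \<le> norm g" for g
      unfolding M_def by (rule norm_moebius_mult_le [OF dm])
    have at_0: "hardy_fun (M g) 0 = b / d * hardy_fun g 0" for g
      by (simp add: M_def hardy_fun_moebius_mult [OF dm] moebius_def)
    have "(norm (T n))\<^sup>2 + (cmod (hardy_fun (T n) 0))\<^sup>2 \<le> L * (\<Sum>k<n. (cmod (hardy_coeff f k))\<^sup>2)"
      using norm_horner_hardy [OF contraction at_0 p, of "map (hardy_coeff f) [0..<n]"]
      unfolding T_def L_def by simp
    then have "(norm (T n))\<^sup>2 \<le> L * (\<Sum>k<n. (cmod (hardy_coeff f k))\<^sup>2)"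
      by (rule order_trans [rotated]) simp
    also have "\<dots> \<le> L * (norm f)\<^sup>2"
      using p by (intro mult_left_mono sum_hardy_coeff_le_norm)
        (simp add: L_def abs_square_le_1 less_imp_le)
    finally show ?thesis .
  qed
  have "continuous_on (cball 0 (1/2)) (\<lambda>z. cmod (\<psi> z))"
    by (intro continuous_intros holomorphic_on_imp_continuous_on
        holomorphic_on_subset [OF \<psi>_hol]) auto
  then obtain z0 where z0: "z0 \<in> cball 0 (1/2)"
    and max: "\<And>z. z \<in> cball 0 (1/2) \<Longrightarrow> cmod (\<psi> z) \<le> cmod (\<psi> z0)"
    using continuous_attains_sup [of "cball 0 (1/2)" "\<lambda>z. cmod (\<psi> z)"] by auto
  define w where "w = \<psi> z0"
  have w1: "cmod w < 1"
    using z0 \<psi>_ball [of z0] by (simp add: w_def)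
  have "uniform_limit (ball 0 (1/2)) (\<lambda>n. hardy_fun (T n)) g sequentially"
  proof (rule uniform_limitI)
    fix e :: real
    assume "e > 0"
    have "(\<lambda>n. norm (truncate_hardy n f - f) / sqrt (1 - (cmod w)\<^sup>2)) \<longlonglongrightarrow> norm (f - f) / sqrt (1 - (cmod w)\<^sup>2)"
      using w1 by (intro tendsto_intros truncate_hardy_tendsto) (simp add: abs_square_eq_1)
    then have "\<forall>\<^sub>F n in sequentially. norm (truncate_hardy n f - f) / sqrt (1 - (cmod w)\<^sup>2) < e"
      using \<open>e > 0\<close> by (intro order_tendstoD) auto
    then show "\<forall>\<^sub>F n in sequentially. \<forall>z\<in>ball 0 (1/2). dist (hardy_fun (T n) z) (g z) < e"
    proof eventually_elim
      case (elim n)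
      show ?case
      proof
        fix z :: complex
        assume z: "z \<in> ball 0 (1/2)"
        then have z1: "z \<in> ball 0 1"
          by simp
        have le: "cmod (\<psi> z) \<le> cmod w"
          unfolding w_def by (rule max) (use z in simp)
        have "dist (hardy_fun (T n) z) (g z) =
            cmod (hardy_fun (truncate_hardy n f) (\<psi> z) - hardy_fun f (\<psi> z))"
          using z1 by (simp add: dist_norm T_eq g_def)
        also have "\<dots> \<le> norm (truncate_hardy n f - f) / sqrt (1 - (cmod (\<psi> z))\<^sup>2)"
          by (rule hardy_fun_diff_le [OF \<psi>_ball [OF z1]])
        also have "\<dots> \<le> norm (truncate_hardy n f - f) / sqrt (1 - (cmod w)\<^sup>2)"
          using w1 le power_mono [OF le, of 2]
          by (intro divide_left_mono mult_pos_pos real_sqrt_le_mono) (auto simp: abs_square_less_1)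
        finally show "dist (hardy_fun (T n) z) (g z) < e"
          using elim by simp
      qed
    qed
  qed
  then have "(\<lambda>n. (deriv ^^ k) (hardy_fun (T n)) 0) \<longlonglongrightarrow> (deriv ^^ k) g 0" for k
    by (rule higher_deriv_complex_uniform_limit)
      (auto intro!: always_eventually holomorphic_on_subset [OF holomorphic_hardy_fun])
  then have lim: "(\<lambda>n. hardy_coeff (T n) k) \<longlonglongrightarrow> taylor_coeff g k" for k
    unfolding hardy_coeff_def taylor_coeff_def by (intro tendsto_intros) auto
  have "hardy_fun f \<circ> \<psi> holomorphic_on ball 0 1"
    by (rule holomorphic_on_compose_gen [OF \<psi>_hol holomorphic_hardy_fun]) (use \<psi>_ball in blast)
  then have g_hol: "g holomorphic_on ball 0 1"
    by (rule holomorphic_transform) (simp add: g_def)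
  have le: "(\<Sum>k<N. (cmod (taylor_coeff g k))\<^sup>2) \<le> L * (norm f)\<^sup>2" for N
  proof (rule LIMSEQ_le_const2)
    show "(\<lambda>n. \<Sum>k<N. (cmod (hardy_coeff (T n) k))\<^sup>2) \<longlonglongrightarrow> (\<Sum>k<N. (cmod (taylor_coeff g k))\<^sup>2)"
      by (intro tendsto_intros lim)
    show "\<exists>n0. \<forall>n\<ge>n0. (\<Sum>k<N. (cmod (hardy_coeff (T n) k))\<^sup>2) \<le> L * (norm f)\<^sup>2"
      using order_trans [OF sum_hardy_coeff_le_norm T_norm] by blast
  qed
  have g: "g \<in> hardy_set" "(norm (Abs_hardy2 g))\<^sup>2 \<le> L * (norm f)\<^sup>2"
    by (rule hardy_set_bounded [OF g_hol _ le]; simp add: g_def)+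
  have comp: "composition_operator \<psi> f = Abs_hardy2 g"
    by (simp only: composition_operator_def g_def)
  show "hardy_fun (composition_operator (moebius a b c d) f) z = hardy_fun f (moebius a b c d z)"
    if "z \<in> ball 0 1"
    unfolding \<psi>_def [symmetric] comp Abs_hardy2_inverse [OF g(1)] using that by (simp add: g_def)
  show "(norm (composition_operator (moebius a b c d) f))\<^sup>2 \<le> L * (norm f)\<^sup>2"
    unfolding \<psi>_def [symmetric] comp by (rule g(2))
qed

section \<open>Hilbert-Schmidt operators are compact\<close>

text \<open>The topology on sequences is the product topology, so the set is closed in a product of
  disks, which is compact by Tychonoff's theorem. This is weak compactness of the unit ball.\<close>

lemma compact_l2_ball: "compact {x :: nat \<Rightarrow> complex. \<forall>N. (\<Sum>n<N. (cmod (x n))\<^sup>2) \<le> 1}"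
proof -
  define X where "X = {x :: nat \<Rightarrow> complex. \<forall>N. (\<Sum>n<N. (cmod (x n))\<^sup>2) \<le> 1}"
  define P where "P = PiE UNIV (\<lambda>_ :: nat. cball 0 1 :: complex set)"
  have "compactin (product_topology (\<lambda>_. euclidean) UNIV) P"
    unfolding P_def compactin_PiE by simp
  then have "compact P"
    by (simp add: euclidean_product_topology)
  moreover have "closed X"
    unfolding X_def
    by (intro closed_Collect_all closed_Collect_le continuous_intros continuous_on_product_coordinates)
  moreover have "P \<inter> X = X"
  proof -
    have "cmod (x n) \<le> 1" if "x \<in> X" for x n
    proof -
      have "(cmod (x n))\<^sup>2 \<le> (\<Sum>k<Suc n. (cmod (x k))\<^sup>2)"
        by (simp add: sum_nonneg)
      also have "\<dots> \<le> 1"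
        using that unfolding X_def by blast
      finally show ?thesis
        by (simp add: abs_square_le_1)
    qed
    then show ?thesis
      unfolding P_def by auto
  qed
  ultimately show ?thesis
    unfolding X_def [symmetric] by (metis compact_Int_closed)
qed

lemma continuous_on_hardy_scale [continuous_intros]:
  assumes "continuous_on S c"
  shows "continuous_on S (\<lambda>x. c x *\<^sub>H v)"
proof -
  have "z *\<^sub>H v = Re z *\<^sub>R v + Im z *\<^sub>R (\<i> *\<^sub>H v)" for z
  proof -
    have "of_real (Re z) + of_real (Im z) * \<i> = z"
      by (simp add: complex_eq_iff)
    then show ?thesis
      unfolding scaleR_hardy2_def hardy.scale_scale hardy.scale_left_distrib [symmetric] by simp
  qed
  then have eq: "(\<lambda>x. c x *\<^sub>H v) = (\<lambda>x. Re (c x) *\<^sub>R v + Im (c x) *\<^sub>R (\<i> *\<^sub>H v))"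
    by (rule ext)
  show ?thesis
    unfolding eq by (intro continuous_intros assms)
qed

text \<open>By the Cauchy-Schwarz inequality the finite-rank operators
  \<open>f \<mapsto> (\<Sum>n<N. hardy_coeff f n *\<^sub>H K (monom_hardy n))\<close> converge to \<open>K\<close> uniformly on the unit ball, and
  each of them is continuous for coefficientwise convergence. Hence so is \<open>K\<close>, and the image of
  the unit ball lies in the continuous image of a compact space.\<close>

lemma hilbert_schmidt_compact:
  assumes lin: "Vector_Spaces.linear hardy_scale hardy_scale K"
    and bounded: "\<And>f. norm (K f) \<le> C * norm f"
    and hs: "summable (\<lambda>n. (norm (K (monom_hardy n)))\<^sup>2)"
  shows "compact_operator K"
proof -
  interpret K: Vector_Spaces.linear hardy_scale hardy_scale K
    by (rule lin)
  define X where "X = {x :: nat \<Rightarrow> complex. \<forall>N. (\<Sum>n<N. (cmod (x n))\<^sup>2) \<le> 1}"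
  define \<Phi> where "\<Phi> = (\<lambda>N x. \<Sum>n<N. x n *\<^sub>H K (monom_hardy n))"
  define \<tau> where "\<tau> = (\<lambda>N. (\<Sum>n. (norm (K (monom_hardy n)))\<^sup>2) - (\<Sum>n<N. (norm (K (monom_hardy n)))\<^sup>2))"
  have K_truncate: "K (truncate_hardy N f) = \<Phi> N (hardy_coeff f)" for N f
    by (simp add: truncate_hardy_def \<Phi>_def K.sum K.scale)
  have K_lim: "(\<lambda>N. \<Phi> N (hardy_coeff f)) \<longlonglongrightarrow> K f" for f
  proof -
    have "(\<lambda>N. C * norm (truncate_hardy N f - f)) \<longlonglongrightarrow> C * norm (f - f)"
      by (intro tendsto_intros truncate_hardy_tendsto)
    then have lim: "(\<lambda>N. C * norm (truncate_hardy N f - f)) \<longlonglongrightarrow> 0"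
      by simp
    have "norm (\<Phi> N (hardy_coeff f) - K f) \<le> C * norm (truncate_hardy N f - f)" for N
      unfolding K_truncate [symmetric] K.diff [symmetric] by (rule bounded)
    then have "(\<lambda>N. \<Phi> N (hardy_coeff f) - K f) \<longlonglongrightarrow> 0"
      by (intro Lim_null_comparison [OF always_eventually lim] allI)
    then show ?thesis
      by (rule LIM_zero_cancel)
  qed
  have tail: "norm (\<Phi> M x - \<Phi> N x) \<le> sqrt (\<tau> N)" if x: "x \<in> X" and "N \<le> M" for M N x
  proof -
    have "\<Phi> M x - \<Phi> N x = (\<Sum>n=N..<M. x n *\<^sub>H K (monom_hardy n))"
      unfolding \<Phi>_def using sum_diff_nat_ivl [of 0 N M] \<open>N \<le> M\<close> by (simp add: atLeast0LessThan)
    also have "norm \<dots> \<le> (\<Sum>n=N..<M. \<bar>cmod (x n)\<bar> * \<bar>norm (K (monom_hardy n))\<bar>)"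
      by (rule sum_norm_le) (simp add: norm_hardy_scale)
    also have "\<dots> \<le> L2_set (\<lambda>n. cmod (x n)) {N..<M} * L2_set (\<lambda>n. norm (K (monom_hardy n))) {N..<M}"
      by (rule L2_set_mult_ineq)
    also have "\<dots> \<le> 1 * sqrt (\<tau> N)"
    proof (rule mult_mono)
      have "(\<Sum>n=N..<M. (cmod (x n))\<^sup>2) \<le> (\<Sum>n<M. (cmod (x n))\<^sup>2)"
        by (rule sum_mono2) auto
      also have "\<dots> \<le> 1"
        using x by (simp add: X_def)
      finally show "L2_set (\<lambda>n. cmod (x n)) {N..<M} \<le> 1"
        by (simp add: L2_set_def)
      have "(\<Sum>n=N..<M. (norm (K (monom_hardy n)))\<^sup>2)
          = (\<Sum>n<M. (norm (K (monom_hardy n)))\<^sup>2) - (\<Sum>n<N. (norm (K (monom_hardy n)))\<^sup>2)"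
        using sum_diff_nat_ivl [of 0 N M "\<lambda>n. (norm (K (monom_hardy n)))\<^sup>2"] \<open>N \<le> M\<close>
        by (simp add: atLeast0LessThan)
      also have "\<dots> \<le> \<tau> N"
        using sum_le_suminf [OF hs, of "{..<M}"] by (simp add: \<tau>_def)
      finally show "L2_set (\<lambda>n. norm (K (monom_hardy n))) {N..<M} \<le> sqrt (\<tau> N)"
        by (simp add: L2_set_def)
    qed (simp_all add: L2_set_nonneg)
    finally show ?thesis
      by simp
  qed
  have of_coeffs: "hardy_coeff (hardy_of_coeffs x) = x" if "x \<in> X" for x
  proof
    have "summable (\<lambda>n. (cmod (x n))\<^sup>2)"
      by (rule summableI_nonneg_bounded [of _ 1]) (use that in \<open>simp_all add: X_def\<close>)
    then show "hardy_coeff (hardy_of_coeffs x) n = x n" for n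
      by (rule hardy_coeff_of_coeffs)
  qed
  have "uniform_limit X \<Phi> (\<lambda>x. K (hardy_of_coeffs x)) sequentially"
  proof (rule uniform_limitI)
    fix e :: real
    assume "e > 0"
    have "(\<lambda>N. sqrt (\<tau> N)) \<longlonglongrightarrow> sqrt ((\<Sum>n. (norm (K (monom_hardy n)))\<^sup>2) - (\<Sum>n. (norm (K (monom_hardy n)))\<^sup>2))"
      unfolding \<tau>_def by (intro tendsto_intros summable_LIMSEQ hs)
    then have "\<forall>\<^sub>F N in sequentially. sqrt (\<tau> N) < e"
      using \<open>e > 0\<close> by (intro order_tendstoD) auto
    then show "\<forall>\<^sub>F N in sequentially. \<forall>x\<in>X. dist (\<Phi> N x) (K (hardy_of_coeffs x)) < e"
    proof eventually_elim
      case (elim N)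
      show ?case
      proof
        fix x
        assume x: "x \<in> X"
        have "(\<lambda>M. norm (\<Phi> M x - \<Phi> N x)) \<longlonglongrightarrow> norm (K (hardy_of_coeffs x) - \<Phi> N x)"
          using K_lim [of "hardy_of_coeffs x"] unfolding of_coeffs [OF x] by (intro tendsto_intros)
        then have "norm (K (hardy_of_coeffs x) - \<Phi> N x) \<le> sqrt (\<tau> N)"
          by (rule LIMSEQ_le_const2) (use tail [OF x] in blast)
        then show "dist (\<Phi> N x) (K (hardy_of_coeffs x)) < e"
          using elim by (simp add: dist_norm norm_minus_commute)
      qed
    qed
  qed
  moreover have "continuous_on X (\<Phi> N)" for N
    unfolding \<Phi>_def
    by (intro continuous_intros continuous_on_subset [OF continuous_on_product_coordinates]) simp
  ultimately have "continuous_on X (\<lambda>x. K (hardy_of_coeffs x))"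
    by (intro uniform_limit_theorem [where F = sequentially]) simp_all
  then have compact: "compact ((\<lambda>x. K (hardy_of_coeffs x)) ` X)"
    using compact_l2_ball unfolding X_def [symmetric] by (rule compact_continuous_image)
  have "K ` ball 0 1 \<subseteq> (\<lambda>x. K (hardy_of_coeffs x)) ` X"
  proof
    fix g
    assume "g \<in> K ` ball 0 1"
    then obtain f where f: "norm f < 1" "g = K f"
      by auto
    have "(norm f)\<^sup>2 \<le> 1"
      using f(1) by (simp add: abs_square_le_1)
    then have "hardy_coeff f \<in> X"
      unfolding X_def using order_trans [OF sum_hardy_coeff_le_norm] by blast
    moreover from this have "hardy_of_coeffs (hardy_coeff f) = f"
      by (intro hardy2_eqI_coeff) (simp add: of_coeffs)
    ultimately show "g \<in> (\<lambda>x. K (hardy_of_coeffs x)) ` X"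
      using f(2) by (metis image_eqI)
  qed
  then have "closure (K ` ball 0 1) \<subseteq> (\<lambda>x. K (hardy_of_coeffs x)) ` X"
    by (intro closure_minimal compact_imp_closed compact)
  then have "compact (closure (K ` ball 0 1))"
    using compact_Int_closed [OF compact closed_closure, of "K ` ball 0 1"]
    by (simp add: Int_absorb1)
  then show ?thesis
    unfolding compact_operator_def using lin by simp
qed

section \<open>Linear-fractional self-maps of the disk and the Krein adjoint\<close>

text \<open>Since division by zero gives \<open>0\<close>, a pole inside the disk has to be excluded first. Off the
  pole \<open>cmod (a * z + b) \<le> cmod (c * z + d)\<close>, and by continuity this holds at the pole too, so
  numerator and denominator would vanish together, contradicting \<open>a * d - b * c \<noteq> 0\<close>. The same
  argument excludes a pole on the unit circle.\<close>

lemma disk_map_moebius: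
  assumes det: "a * d - b * c \<noteq> 0" and sub: "moebius a b c d ` ball 0 1 \<subseteq> ball 0 1"
  shows "disk_map a b c d"
proof -
  have not_both: "a * z + b \<noteq> 0" if "c * z + d = 0" for z
  proof
    assume "a * z + b = 0"
    then have "b = - (a * z)" "d = - (c * z)"
      using that by (simp_all add: eq_neg_iff_add_eq_0 add.commute)
    then show False
      using det by simp
  qed
  have less: "cmod (a * z + b) < cmod (c * z + d)" if "z \<in> ball 0 1" "c * z + d \<noteq> 0" for z
  proof -
    have "moebius a b c d z \<in> ball 0 1"
      using sub that(1) by blast
    then show ?thesis
      using that(2) by (simp add: moebius_def norm_divide)
  qed
  have nz: "c * w + d \<noteq> 0" if w: "w \<in> ball 0 1" for w
  proof
    assume 0: "c * w + d = 0"
    have "c \<noteq> 0"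
      using 0 det by auto
    have "w islimpt ball 0 1"
      using w by (intro interior_limit_point) simp
    then have "w \<in> closure (ball 0 1 - {w})"
      by (simp add: islimpt_in_closure)
    moreover have "closure (ball 0 1 - {w}) \<subseteq> {z. cmod (a * z + b) \<le> cmod (c * z + d)}"
    proof (rule closure_minimal)
      show "ball 0 1 - {w} \<subseteq> {z. cmod (a * z + b) \<le> cmod (c * z + d)}"
      proof
        fix z
        assume z: "z \<in> ball 0 1 - {w}"
        have "c * z + d = c * (z - w)"
          using 0 by (simp add: algebra_simps add_eq_0_iff)
        then show "z \<in> {z. cmod (a * z + b) \<le> cmod (c * z + d)}"
          using less [of z] z \<open>c \<noteq> 0\<close> by simp
      qed
      show "closed {z. cmod (a * z + b) \<le> cmod (c * z + d)}"
        by (intro closed_Collect_le continuous_intros)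
    qed
    ultimately have "cmod (a * w + b) \<le> cmod (c * w + d)"
      by blast
    then show False
      using 0 not_both [OF 0] by simp
  qed
  have "cmod c < cmod d"
  proof (rule ccontr)
    assume "\<not> cmod c < cmod d"
    then have le: "cmod d \<le> cmod c"
      by simp
    have "c \<noteq> 0"
      using le det by auto
    define z where "z = - d / c"
    have 0: "c * z + d = 0"
      using \<open>c \<noteq> 0\<close> by (simp add: z_def)
    have "z \<in> cball 0 1"
      using le \<open>c \<noteq> 0\<close> by (simp add: z_def norm_divide divide_le_eq_1)
    then have "cmod (a * z + b) \<le> cmod (c * z + d)"
      by (rule cmod_le_cball [rotated]) (use less nz in \<open>simp add: less_imp_le\<close>)
    then show False
      using 0 not_both [OF 0] by simp
  qed
  then show ?thesis
    unfolding disk_map_def using less nz by blast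
qed

text \<open>The relation between a map and its Krein adjoint is that
  \<open>(c * w + d) - u * (a * w + b) = (d - b * u) + (c - a * u) * w\<close> with \<open>u = cnj z\<close>. For \<open>cmod u < 1\<close> the left-hand
  side has no zero \<open>w\<close> in the closed disk, because \<open>moebius a b c d\<close> maps it into itself. So the
  affine function of \<open>w\<close> on the right has no zero there either, that is,
  \<open>cmod (c - a * u) < cmod (d - b * u)\<close>.\<close>

lemma disk_map_krein_adjoint:
  assumes "disk_map a b c d"
  shows "disk_map (cnj a) (- cnj c) (- cnj b) (cnj d)"
proof -
  have cd: "cmod c < cmod d" and less: "\<And>z. z \<in> ball 0 1 \<Longrightarrow> cmod (a * z + b) < cmod (c * z + d)"
    using assms by (auto simp: disk_map_def)
  have "cmod (cnj a * z + - cnj c) < cmod (- cnj b * z + cnj d)" if z: "z \<in> ball 0 1" for z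
  proof (rule ccontr)
    define u p q where "u = cnj z" and "p = d - b * u" and "q = c - a * u"
    assume "\<not> cmod (cnj a * z + - cnj c) < cmod (- cnj b * z + cnj d)"
    moreover have "cmod (- cnj b * z + cnj d) = cmod p"
      unfolding p_def u_def by (subst complex_mod_cnj [symmetric]) (simp add: algebra_simps)
    moreover have "cmod (cnj a * z + - cnj c) = cmod q"
      unfolding q_def u_def
      by (subst complex_mod_cnj [symmetric], subst norm_minus_cancel [symmetric]) (simp add: algebra_simps)
    ultimately have le: "cmod p \<le> cmod q"
      by simp
    define w where "w = - p / q"
    have w: "w \<in> cball 0 1"
      using le by (auto simp: w_def norm_divide divide_le_eq_1)
    have "p + q * w = 0"
      using le by (cases "q = 0") (simp_all add: w_def)
    then have eq: "c * w + d = u * (a * w + b)"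
      by (simp add: p_def q_def algebra_simps)
    have "cmod (c * w + d) = cmod u * cmod (a * w + b)"
      unfolding eq norm_mult ..
    also have "\<dots> \<le> cmod u * cmod (c * w + d)"
      by (intro mult_left_mono cmod_le_cball [OF _ w]) (simp_all add: less less_imp_le)
    also have "\<dots> < 1 * cmod (c * w + d)"
      using z affine_nonzero [OF cd w] by (intro mult_strict_right_mono) (simp_all add: u_def)
    finally show False
      by simp
  qed
  moreover have "cmod (- cnj b) < cmod (cnj d)"
    using less [of 0] by simp
  ultimately show ?thesis
    unfolding disk_map_def by blast
qed

text \<open>The norm form of \<open>\<bar>c * z + d\<bar>\<^sup>2 - \<bar>a * z + b\<bar>\<^sup>2 = \<kappa> * \<bar>z - \<eta>\<bar>\<^sup>2\<close> on the unit circle, valid for a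
  self-map of the disk that sends \<open>\<eta>\<close> to the circle. Both sides depend on \<open>f\<close> only through its norm and
  \<open>hardy_inner (shift_hardy f) f\<close>, so it suffices to compare coefficients.\<close>

lemma norm_affine_mult_defect:
  assumes dm: "disk_map a b c d" and \<eta>: "cmod \<eta> = 1" "cmod (a * \<eta> + b) = cmod (c * \<eta> + d)"
  defines "\<kappa> \<equiv> cmod (c * cnj d - a * cnj b)"
  shows "(norm (affine_mult c d f))\<^sup>2 - (norm (affine_mult a b f))\<^sup>2 = \<kappa> * (norm (affine_mult 1 (- \<eta>) f))\<^sup>2"
    and "(cmod c)\<^sup>2 + (cmod d)\<^sup>2 - ((cmod a)\<^sup>2 + (cmod b)\<^sup>2) = 2 * \<kappa>"
proof -
  define A B where "A = (cmod c)\<^sup>2 + (cmod d)\<^sup>2 - ((cmod a)\<^sup>2 + (cmod b)\<^sup>2)"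
    and "B = c * cnj d - a * cnj b"
  have diff: "A + 2 * Re (B * z) = (cmod (c * z + d))\<^sup>2 - (cmod (a * z + b))\<^sup>2" if "cmod z = 1" for z
    unfolding cmod_affine_sq using that by (simp add: A_def B_def algebra_simps)
  have nonneg: "0 \<le> A + 2 * Re (B * z)" if "cmod z = 1" for z
  proof -
    have "cmod (a * z + b) \<le> cmod (c * z + d)"
      by (rule cmod_le_cball) (use dm that in \<open>auto simp: disk_map_def less_imp_le\<close>)
    then show ?thesis
      unfolding diff [OF that] by (simp add: power_mono)
  qed
  have zero: "A + 2 * Re (B * \<eta>) = 0"
    unfolding diff [OF \<eta>(1)] \<eta>(2) by simp
  have A: "A = 2 * \<kappa>" and B: "B = - of_real \<kappa> * cnj \<eta>"
    using circle_trig_zero [OF nonneg \<eta>(1) zero] by (simp_all add: \<kappa>_def B_def)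
  show "(cmod c)\<^sup>2 + (cmod d)\<^sup>2 - ((cmod a)\<^sup>2 + (cmod b)\<^sup>2) = 2 * \<kappa>"
    using A by (simp add: A_def)
  define v where "v = hardy_inner (shift_hardy f) f"
  have "(norm (affine_mult c d f))\<^sup>2 - (norm (affine_mult a b f))\<^sup>2 = A * (norm f)\<^sup>2 + 2 * Re (B * v)"
    by (simp add: norm_affine_mult A_def B_def v_def algebra_simps)
  also have "\<dots> = \<kappa> * (2 * (norm f)\<^sup>2 - 2 * Re (cnj \<eta> * v))"
    by (simp add: A B algebra_simps)
  also have "\<dots> = \<kappa> * (norm (affine_mult 1 (- \<eta>) f))\<^sup>2"
    by (simp add: norm_affine_mult \<eta>(1) v_def)
  finally show "(norm (affine_mult c d f))\<^sup>2 - (norm (affine_mult a b f))\<^sup>2 = \<kappa> * (norm (affine_mult 1 (- \<eta>) f))\<^sup>2" .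
qed

text \<open>The two equations say that the Krein adjoint has constant modulus one on the unit circle, that is,
  \<open>\<kappa> = 0\<close> for its coefficients. They turn \<open>\<bar>a - c * w\<bar>\<^sup>2 - \<bar>d * w - b\<bar>\<^sup>2\<close> into a positive multiple of
  \<open>1 - \<bar>w\<bar>\<^sup>2\<close>, so the inverse map sends the disk into itself.\<close>

lemma moebius_onto_ball:
  assumes dm: "disk_map a b c d" and det: "a * d - b * c \<noteq> 0"
    and sum: "(cmod b)\<^sup>2 + (cmod d)\<^sup>2 = (cmod a)\<^sup>2 + (cmod c)\<^sup>2" and cross: "cnj a * c = cnj b * d"
  shows "ball 0 1 \<subseteq> moebius a b c d ` ball 0 1"
proof
  fix w :: complex
  assume w: "w \<in> ball 0 1"
  have "(cmod c)\<^sup>2 < (cmod d)\<^sup>2"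
    using dm by (intro power_strict_mono) (auto simp: disk_map_def)
  then have ab: "0 < (cmod a)\<^sup>2 - (cmod b)\<^sup>2"
    using sum by simp
  have "(cmod (- c * w + a))\<^sup>2 - (cmod (d * w + - b))\<^sup>2 = ((cmod a)\<^sup>2 - (cmod b)\<^sup>2) * (1 - (cmod w)\<^sup>2)"
  proof -
    have c2: "(cmod c)\<^sup>2 = (cmod b)\<^sup>2 + (cmod d)\<^sup>2 - (cmod a)\<^sup>2"
      using sum by simp
    define t where "t = Re (d * cnj (- b) * w)"
    have "c * cnj a = d * cnj b"
      using cross by (simp add: mult.commute)
    then have t: "Re (- c * cnj a * w) = t"
      unfolding t_def complex_cnj_minus mult_minus_left mult_minus_right by simp
    show ?thesis
      unfolding cmod_affine_sq norm_minus_cancel c2 t t_def [symmetric] by (simp add: algebra_simps)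
  qed
  also have "\<dots> > 0"
    using ab w by (intro mult_pos_pos) (simp_all add: abs_square_less_1)
  finally have "(cmod (d * w + - b))\<^sup>2 < (cmod (- c * w + a))\<^sup>2"
    by (simp only: diff_gt_0_iff_gt)
  then have less: "cmod (d * w + - b) < cmod (- c * w + a)"
    by (rule power_less_imp_less_base) simp
  then have nz: "- c * w + a \<noteq> 0"
    using norm_ge_zero [of "d * w + - b"] by force
  define z where "z = moebius d (- b) (- c) a w"
  have "cmod z < 1"
    using less nz by (simp add: z_def moebius_def norm_divide)
  moreover have "moebius a b c d z = w"
    using moebius_inverse [of d a "- b" "- c" w] det nz by (simp add: z_def mult.commute)
  ultimately show "w \<in> moebius a b c d ` ball 0 1"
    by (metis image_eqI mem_ball_0)
qed

section \<open>The adjoint of a composition operator\<close>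

lemma norm_composition_le:
  assumes "disk_map a b c d"
  obtains C where "C \<ge> 0" "\<And>f. norm (composition_operator (moebius a b c d) f) \<le> C * norm f"
proof
  define L where "L = 2 + 4 * (cmod (b / d))\<^sup>2 / (1 - (cmod (b / d))\<^sup>2)"
  have "(norm (composition_operator (moebius a b c d) f))\<^sup>2 \<le> L * (norm f)\<^sup>2" for f
    unfolding L_def by (rule norm_composition_sq_le [OF assms])
  then have "norm (composition_operator (moebius a b c d) f) \<le> sqrt (L * (norm f)\<^sup>2)" for f
    by (rule real_le_rsqrt)
  then show "norm (composition_operator (moebius a b c d) f) \<le> sqrt \<bar>L\<bar> * norm f" for f
    by (rule order_trans) (simp add: real_sqrt_mult real_sqrt_le_mono mult_right_mono)
  show "sqrt \<bar>L\<bar> \<ge> 0"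
    by simp
qed

lemma composition_add:
  assumes "disk_map a b c d"
  shows "composition_operator (moebius a b c d) (f + g) =
    composition_operator (moebius a b c d) f + composition_operator (moebius a b c d) g"
proof (rule hardy2_eqI)
  show "hardy_fun (composition_operator (moebius a b c d) (f + g)) z =
      hardy_fun (composition_operator (moebius a b c d) f + composition_operator (moebius a b c d) g) z" for z
    by (cases "z \<in> ball 0 1")
      (simp_all add: hardy_fun_add hardy_fun_composition [OF assms] hardy_fun_outside)
qed

lemma composition_scale:
  assumes "disk_map a b c d"
  shows "composition_operator (moebius a b c d) (r *\<^sub>H f) = r *\<^sub>H composition_operator (moebius a b c d) f"
proof (rule hardy2_eqI)
  show "hardy_fun (composition_operator (moebius a b c d) (r *\<^sub>H f)) z =
      hardy_fun (r *\<^sub>H composition_operator (moebius a b c d) f) z" for z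
    by (cases "z \<in> ball 0 1")
      (simp_all add: hardy_fun_scale hardy_fun_composition [OF assms] hardy_fun_outside)
qed

text \<open>The span of the kernels is dense. Applied to the kernel at \<open>z\<close>, a bounded functional is
  a power series in \<open>cnj z\<close> whose coefficients are its values on the monomials; if the series
  vanishes identically, so do its coefficients.\<close>

lemma functional_zero_on_kernels:
  assumes add: "\<And>f g. \<Lambda> (f + g) = \<Lambda> f + \<Lambda> g" and scale: "\<And>r f. \<Lambda> (r *\<^sub>H f) = r * \<Lambda> f"
    and bounded: "\<And>f. cmod (\<Lambda> f) \<le> C * norm f"
    and kernels: "\<And>w. w \<in> ball 0 1 \<Longrightarrow> \<Lambda> (kernel_hardy w) = 0"
  shows "\<Lambda> f = 0"
proof -
  have \<Lambda>_sums: "(\<lambda>n. hardy_coeff f n * \<Lambda> (monom_hardy n)) sums \<Lambda> f" for f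
  proof -
    have zero: "\<Lambda> 0 = 0"
      using scale [of 0 0] by simp
    have trunc: "\<Lambda> (truncate_hardy N f) = (\<Sum>n<N. hardy_coeff f n * \<Lambda> (monom_hardy n))" for N
      by (induction N) (simp_all add: truncate_hardy_def zero add scale)
    have diff: "\<Lambda> (g - h) = \<Lambda> g - \<Lambda> h" for g h
      using add [of "g - h" h] by simp
    have "(\<lambda>N. C * norm (truncate_hardy N f - f)) \<longlonglongrightarrow> C * norm (f - f)"
      by (intro tendsto_intros truncate_hardy_tendsto)
    then have lim: "(\<lambda>N. C * norm (truncate_hardy N f - f)) \<longlonglongrightarrow> 0"
      by simp
    have "cmod ((\<Sum>n<N. hardy_coeff f n * \<Lambda> (monom_hardy n)) - \<Lambda> f) \<le> C * norm (truncate_hardy N f - f)" for N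
      unfolding trunc [symmetric] diff [symmetric] by (rule bounded)
    then have "(\<lambda>N. (\<Sum>n<N. hardy_coeff f n * \<Lambda> (monom_hardy n)) - \<Lambda> f) \<longlonglongrightarrow> 0"
      by (intro Lim_null_comparison [OF always_eventually lim] allI)
    then show ?thesis
      unfolding sums_def by (rule LIM_zero_cancel)
  qed
  have "(\<lambda>n. cnj (\<Lambda> (monom_hardy n)) * z ^ n) sums 0" if "z \<in> ball 0 1" for z
  proof -
    have "(\<lambda>n. cnj (cnj z ^ n * \<Lambda> (monom_hardy n))) sums cnj 0"
      unfolding sums_cnj
      using \<Lambda>_sums [of "kernel_hardy z"] by (simp only: hardy_coeff_kernel [OF that] kernels [OF that])
    then show ?thesis
      by (simp add: mult.commute)
  qed
  then have "taylor_coeff (\<lambda>z. 0) n = cnj (\<Lambda> (monom_hardy n))" for n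
    by (rule taylor_coeff_unique)
  then have "\<Lambda> (monom_hardy n) = 0" for n
    by simp
  then show ?thesis
    using \<Lambda>_sums [of f] by (simp add: sums_iff)
qed

text \<open>Cowen's formula for the adjoint of the composition with \<open>moebius a b c d\<close>, as a product of
  three bounded operators: the adjoint of the multiplication by \<open>c * z + d\<close>, the composition with
  the Krein adjoint, and the division by \<open>- cnj b * z + cnj d\<close>.\<close>

definition cowen_adjoint :: "complex \<Rightarrow> complex \<Rightarrow> complex \<Rightarrow> complex \<Rightarrow> hardy2 \<Rightarrow> hardy2" where
  "cowen_adjoint a b c d f =
     affine_div (- cnj b) (cnj d)
       (composition_operator (moebius (cnj a) (- cnj c) (- cnj b) (cnj d))
         (cnj c *\<^sub>H backshift_hardy f + cnj d *\<^sub>H f))"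

lemma hardy_fun_cowen_adjoint:
  assumes dm: "disk_map a b c d" and z: "z \<in> ball 0 1"
  defines "w \<equiv> moebius (cnj a) (- cnj c) (- cnj b) (cnj d) z"
  shows "hardy_fun (cowen_adjoint a b c d f) z =
    (cnj c * hardy_fun (backshift_hardy f) w + cnj d * hardy_fun f w) / (- cnj b * z + cnj d)"
proof -
  note dm' = disk_map_krein_adjoint [OF dm]
  then have "cmod (- cnj b) < cmod (cnj d)"
    by (simp add: disk_map_def)
  then show ?thesis
    using z unfolding cowen_adjoint_def w_def
    by (simp add: hardy_fun_affine_div hardy_fun_composition [OF dm'] hardy_fun_add hardy_fun_scale)
qed

lemma norm_cowen_adjoint_le:
  assumes dm: "disk_map a b c d"
  obtains C where "\<And>f. norm (cowen_adjoint a b c d f) \<le> C * norm f"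
proof -
  note dm' = disk_map_krein_adjoint [OF dm]
  then have bd: "cmod (- cnj b) < cmod (cnj d)"
    by (simp add: disk_map_def)
  define \<delta> where "\<delta> = cmod (cnj d) - cmod (- cnj b)"
  have \<delta>: "\<delta> > 0"
    using bd by (simp add: \<delta>_def)
  obtain C where C: "C \<ge> 0"
    "\<And>f. norm (composition_operator (moebius (cnj a) (- cnj c) (- cnj b) (cnj d)) f) \<le> C * norm f"
    using norm_composition_le [OF dm'] by blast
  show ?thesis
  proof
    fix f
    have "norm (cnj c *\<^sub>H backshift_hardy f + cnj d *\<^sub>H f) \<le> cmod c * norm (backshift_hardy f) + cmod d * norm f"
      using norm_triangle_ineq [of "cnj c *\<^sub>H backshift_hardy f" "cnj d *\<^sub>H f"]
      by (simp add: norm_hardy_scale)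
    also have "\<dots> \<le> (cmod c + cmod d) * norm f"
      by (simp add: distrib_right mult_left_mono norm_backshift_le)
    finally have "C * norm (cnj c *\<^sub>H backshift_hardy f + cnj d *\<^sub>H f) \<le> C * ((cmod c + cmod d) * norm f)"
      by (rule mult_left_mono [OF _ C(1)])
    with C(2) have "norm (composition_operator (moebius (cnj a) (- cnj c) (- cnj b) (cnj d))
        (cnj c *\<^sub>H backshift_hardy f + cnj d *\<^sub>H f)) / \<delta> \<le> C * ((cmod c + cmod d) * norm f) / \<delta>"
      using \<delta> by (intro divide_right_mono order_trans [OF C(2)]) auto
    then have "norm (cowen_adjoint a b c d f) \<le> C * ((cmod c + cmod d) * norm f) / \<delta>"
      unfolding cowen_adjoint_def \<delta>_def by (rule order_trans [OF norm_affine_div_le [OF bd]])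
    then show "norm (cowen_adjoint a b c d f) \<le> C * (cmod c + cmod d) / \<delta> * norm f"
      by (simp add: mult.assoc)
  qed
qed

text \<open>A composition operator maps kernels to multiples of kernels, up to the factor \<open>c * u + d\<close>:
  clearing denominators in \<open>1 / (1 - cnj z * v)\<close> with \<open>v = moebius a b c d u\<close> gives the affine function
  \<open>(d - b * cnj z) + (c - a * cnj z) * u\<close>, whose quotient of coefficients is \<open>- cnj (\<sigma> z)\<close> for the
  Krein adjoint \<open>\<sigma>\<close>.\<close>

lemma composition_kernel:
  assumes dm: "disk_map a b c d" and z: "z \<in> ball 0 1"
  defines "w \<equiv> moebius (cnj a) (- cnj c) (- cnj b) (cnj d) z"
  shows "composition_operator (moebius a b c d) (kernel_hardy z) =
    cnj (1 / (- cnj b * z + cnj d)) *\<^sub>H affine_mult c d (kernel_hardy w)"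
proof (rule hardy2_eqI)
  fix u
  note dm' = disk_map_krein_adjoint [OF dm]
  have w: "w \<in> ball 0 1"
    unfolding w_def by (rule moebius_in_ball [OF dm' z])
  show "hardy_fun (composition_operator (moebius a b c d) (kernel_hardy z)) u =
      hardy_fun (cnj (1 / (- cnj b * z + cnj d)) *\<^sub>H affine_mult c d (kernel_hardy w)) u"
  proof (cases "u \<in> ball 0 1")
    case True
    define p where "p = d - b * cnj z"
    define v where "v = moebius a b c d u"
    have v: "v \<in> ball 0 1"
      unfolding v_def by (rule moebius_in_ball [OF dm True])
    have unit_nz: "1 - cnj x * y \<noteq> 0" if "x \<in> ball 0 1" "y \<in> ball 0 1" for x y :: complex
    proof -
      have "cmod (cnj x * y) < 1"
        using that mult_strict_mono' [of "cmod x" 1 "cmod y" 1] by (simp add: norm_mult)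
      then show ?thesis
        by auto
    qed
    have cu: "c * u + d \<noteq> 0"
      using dm True by (intro affine_nonzero) (auto simp: disk_map_def)
    have "- cnj b * z + cnj d \<noteq> 0"
      using dm' z by (intro affine_nonzero) (auto simp: disk_map_def)
    moreover have p_cnj: "cnj (- cnj b * z + cnj d) = p"
      by (simp add: p_def)
    ultimately have p: "p \<noteq> 0"
      by (metis complex_cnj_zero_iff)
    have cnj_w: "cnj w * p = a * cnj z - c"
      using p by (simp add: w_def moebius_def p_def)
    have v_eq: "v * (c * u + d) = a * u + b"
      using cu by (simp add: v_def moebius_def)
    have key: "(1 - cnj z * v) * (c * u + d) = p * (1 - cnj w * u)"
    proof -
      have "(1 - cnj z * v) * (c * u + d) = c * u + d - cnj z * (v * (c * u + d))"
        by (simp add: algebra_simps)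
      also have "\<dots> = p - (cnj w * p) * u"
        unfolding v_eq cnj_w by (simp add: p_def algebra_simps)
      finally show ?thesis
        by (simp add: algebra_simps)
    qed
    have "1 / (1 - cnj z * v) = (c * u + d) / (p * (1 - cnj w * u))"
      unfolding key [symmetric] using cu by simp
    then have "hardy_fun (composition_operator (moebius a b c d) (kernel_hardy z)) u =
        (c * u + d) / (p * (1 - cnj w * u))"
      using hardy_fun_composition [OF dm True] hardy_fun_kernel [OF z v] by (simp add: v_def)
    moreover have "cnj (1 / (- cnj b * z + cnj d)) = 1 / p"
      unfolding complex_cnj_divide p_cnj by simp
    ultimately show ?thesis
      by (simp add: hardy_fun_scale hardy_fun_affine_mult hardy_fun_kernel [OF w True])
  qed (simp add: hardy_fun_outside)
qed

lemma hardy_adjoint_composition: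
  assumes dm: "disk_map a b c d"
  shows "hardy_adjoint (composition_operator (moebius a b c d)) = cowen_adjoint a b c d"
proof (rule hardy_adjoint_eqI)
  fix f g
  let ?C = "composition_operator (moebius a b c d)"
  define \<Lambda> where "\<Lambda> = (\<lambda>f. hardy_inner (?C f) g - hardy_inner f (cowen_adjoint a b c d g))"
  note dm' = disk_map_krein_adjoint [OF dm]
  obtain C where C: "\<And>f. norm (?C f) \<le> C * norm f"
    using norm_composition_le [OF dm] by blast
  have "\<Lambda> f = 0"
  proof (rule functional_zero_on_kernels)
    show "\<Lambda> (f + h) = \<Lambda> f + \<Lambda> h" for f h
      by (simp add: \<Lambda>_def composition_add [OF dm] hardy_inner_add_left)
    show "\<Lambda> (r *\<^sub>H f) = r * \<Lambda> f" for r f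
      by (simp add: \<Lambda>_def composition_scale [OF dm] hardy_inner_scale_left right_diff_distrib)
    show "cmod (\<Lambda> f) \<le> (C * norm g + norm (cowen_adjoint a b c d g)) * norm f" for f
    proof -
      have "cmod (\<Lambda> f) \<le> cmod (hardy_inner (?C f) g) + cmod (hardy_inner f (cowen_adjoint a b c d g))"
        unfolding \<Lambda>_def by (rule norm_triangle_ineq4)
      also have "\<dots> \<le> C * norm f * norm g + norm f * norm (cowen_adjoint a b c d g)"
        by (intro add_mono hardy_Cauchy_Schwarz order_trans [OF hardy_Cauchy_Schwarz]
            mult_right_mono C norm_ge_zero)
      finally show ?thesis
        by (simp add: algebra_simps)
    qed
    show "\<Lambda> (kernel_hardy z) = 0" if z: "z \<in> ball 0 1" for z
    proof -
      define w where "w = moebius (cnj a) (- cnj c) (- cnj b) (cnj d) z"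
      define G where "G = 1 / (- cnj b * z + cnj d)"
      have w: "w \<in> ball 0 1"
        unfolding w_def by (rule moebius_in_ball [OF dm' z])
      have k: "hardy_inner (kernel_hardy v) h = cnj (hardy_fun h v)" if "v \<in> ball 0 1" for v h
        using hardy_inner_kernel [OF that, of h] hardy_inner_commute by metis
      have sk: "hardy_inner (shift_hardy (kernel_hardy w)) g = cnj (hardy_fun (backshift_hardy g) w)"
        using hardy_inner_backshift [of g "kernel_hardy w"] hardy_inner_kernel [OF w]
          hardy_inner_commute by metis
      have "hardy_inner (?C (kernel_hardy z)) g =
          cnj G * (c * cnj (hardy_fun (backshift_hardy g) w) + d * cnj (hardy_fun g w))"
        unfolding composition_kernel [OF dm z] w_def [symmetric] G_def [symmetric]
        by (simp add: affine_mult_def hardy_inner_scale_left hardy_inner_add_left sk k [OF w])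
      also have "\<dots> = cnj (hardy_fun (cowen_adjoint a b c d g) z)"
        unfolding hardy_fun_cowen_adjoint [OF dm z] w_def [symmetric] by (simp add: G_def)
      also have "\<dots> = hardy_inner (kernel_hardy z) (cowen_adjoint a b c d g)"
        by (simp only: k [OF z])
      finally show ?thesis
        by (simp add: \<Lambda>_def)
    qed
  qed
  then show "hardy_inner (?C f) g = hardy_inner f (cowen_adjoint a b c d g)"
    by (simp add: \<Lambda>_def)
qed

section \<open>The difference is a Hilbert-Schmidt operator\<close>

text \<open>Here \<open>h = \<psi> ^ n / (c * z + d)\<close> is put into \<open>norm_affine_mult_defect\<close>, where
  \<open>\<psi> = moebius a b c d\<close>. Multiplying \<open>h\<close> by \<open>c * z + d\<close> gives \<open>\<psi> ^ n\<close>, and multiplying it by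
  \<open>a * z + b\<close> gives \<open>\<psi> ^ Suc n\<close>, so the sum telescopes.\<close>

lemma affine_defect_summable:
  assumes dm: "disk_map a b c d" and \<eta>: "cmod \<eta> = 1" "cmod (a * \<eta> + b) = cmod (c * \<eta> + d)"
    and pos: "c * cnj d \<noteq> a * cnj b"
  shows "summable (\<lambda>n. (norm (affine_mult 1 (- \<eta>) (affine_div c d
    (composition_operator (moebius a b c d) (monom_hardy n)))))\<^sup>2)"
proof (rule summableI_nonneg_bounded)
  define \<kappa> where "\<kappa> = cmod (c * cnj d - a * cnj b)"
  define e where "e = (\<lambda>n. composition_operator (moebius a b c d) (monom_hardy n))"
  have cd: "cmod c < cmod d"
    using dm by (simp add: disk_map_def)
  have \<kappa>: "\<kappa> > 0"
    using pos by (simp add: \<kappa>_def)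
  have e_fun: "hardy_fun (e n) z = moebius a b c d z ^ n" if "z \<in> ball 0 1" for n z
    unfolding e_def hardy_fun_composition [OF dm that]
    by (rule hardy_fun_monom [OF moebius_in_ball [OF dm that]])
  have e_Suc: "affine_mult a b (affine_div c d (e n)) = e (Suc n)" for n
  proof (rule hardy2_eqI)
    show "hardy_fun (affine_mult a b (affine_div c d (e n))) z = hardy_fun (e (Suc n)) z" for z
      by (cases "z \<in> ball 0 1")
        (simp_all add: hardy_fun_moebius_mult [OF dm] e_fun hardy_fun_outside)
  qed
  have step: "\<kappa> * (norm (affine_mult 1 (- \<eta>) (affine_div c d (e n))))\<^sup>2 = (norm (e n))\<^sup>2 - (norm (e (Suc n)))\<^sup>2" for n
    using norm_affine_mult_defect(1) [OF dm \<eta>, of "affine_div c d (e n)"]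
    unfolding \<kappa>_def affine_mult_div [OF cd] e_Suc by simp
  fix N
  have "\<kappa> * (\<Sum>n<N. (norm (affine_mult 1 (- \<eta>) (affine_div c d (e n))))\<^sup>2) = (norm (e 0))\<^sup>2 - (norm (e N))\<^sup>2"
    unfolding sum_distrib_left step by (rule sum_lessThan_telescope')
  also have "\<dots> \<le> (norm (e 0))\<^sup>2"
    by simp
  finally show "(\<Sum>n<N. (norm (affine_mult 1 (- \<eta>) (affine_div c d
      (composition_operator (moebius a b c d) (monom_hardy n)))))\<^sup>2) \<le> (norm (e 0))\<^sup>2 / \<kappa>"
    using \<kappa> by (simp add: e_def pos_le_divide_eq mult.commute)
qed simp

text \<open>On \<open>z ^ Suc n\<close> the adjoint and \<open>s C\<^sub>\<sigma>\<close> differ by \<open>w ^ n\<close> times the left-hand side, where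
  \<open>w = \<sigma> z\<close> (the letters \<open>a, b, c, d, \<xi>\<close> stand for the conjugates). It vanishes at \<open>z = \<eta>\<close>, where
  \<open>w = \<zeta>\<close>. To factor out \<open>z - \<eta>\<close>, it is written as
  \<open>(F - G) * (c + d * w) + G * c * (1 - \<xi> * w)\<close> with \<open>F = 1 / (- b * z + d)\<close>, and both \<open>F - G\<close> and
  \<open>1 - \<xi> * w\<close> are multiples of \<open>(z - \<eta>) * F * G\<close>.\<close>

lemma cowen_symbol_factor:
  fixes a b c d \<eta> \<zeta> z :: complex
  assumes D: "- b * z + d \<noteq> 0" and D\<eta>: "- b * \<eta> + d \<noteq> 0"
    and N\<eta>: "a * \<eta> - c = \<zeta> * (- b * \<eta> + d)" and \<xi>: "\<xi> * \<zeta> = 1"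
  defines "G \<equiv> 1 / (- b * \<eta> + d)"
    and "w \<equiv> (a * z + - c) / (- b * z + d)"
  shows "(c + d * w) / (- b * z + d) - (c * \<xi> + d) / (- b * \<eta> + d) * w =
    (z - \<eta>) / (- b * z + d) * ((G * b * c - G\<^sup>2 * c * \<xi> * (a * d - b * c)) + (G * b * d) * w)"
proof -
  define F where "F = 1 / (- b * z + d)"
  have FG: "F - G = b * (z - \<eta>) * F * G"
    using D D\<eta> by (simp add: F_def G_def field_simps)
  have w\<eta>: "\<zeta> = (a * \<eta> - c) * G"
    using N\<eta> D\<eta> by (simp add: G_def)
  have "w - \<zeta> = (a * d - b * c) * (z - \<eta>) * F * G"
    unfolding w\<eta> w_def using D D\<eta> by (simp add: F_def G_def field_simps)
  then have "\<xi> * w - \<xi> * \<zeta> = \<xi> * ((a * d - b * c) * (z - \<eta>) * F * G)"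
    by (simp add: right_diff_distrib [symmetric])
  then have \<xi>w: "1 - \<xi> * w = - (\<xi> * ((a * d - b * c) * (z - \<eta>) * F * G))"
    unfolding \<xi> by (simp add: algebra_simps)
  have "(c + d * w) * F - (c * \<xi> + d) * G * w = (F - G) * (c + d * w) + G * c * (1 - \<xi> * w)"
    by (simp add: algebra_simps)
  also have "\<dots> = (z - \<eta>) * F * ((G * b * c - G\<^sup>2 * c * \<xi> * (a * d - b * c)) + (G * b * d) * w)"
    unfolding FG \<xi>w by (simp add: algebra_simps power2_eq_square)
  finally show ?thesis
    by (simp add: F_def G_def)
qed

lemma backshift_add: "backshift_hardy (f + g) = backshift_hardy f + backshift_hardy g"
  by (rule hardy2_eqI_coeff) (simp add: hardy_coeff_backshift hardy_coeff_add)

lemma backshift_scale: "backshift_hardy (r *\<^sub>H f) = r *\<^sub>H backshift_hardy f"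
  by (rule hardy2_eqI_coeff) (simp add: hardy_coeff_backshift hardy_coeff_scale)

lemma backshift_monom: "backshift_hardy (monom_hardy (Suc n)) = monom_hardy n"
  by (rule hardy2_eqI_coeff) (simp add: hardy_coeff_backshift hardy_coeff_monom)

lemma linear_cowen_diff:
  assumes dm: "disk_map a b c d"
  shows "Vector_Spaces.linear hardy_scale hardy_scale
    (\<lambda>f. cowen_adjoint a b c d f - s *\<^sub>H composition_operator (moebius (cnj a) (- cnj c) (- cnj b) (cnj d)) f)"
proof -
  note dm' = disk_map_krein_adjoint [OF dm]
  let ?S = "composition_operator (moebius (cnj a) (- cnj c) (- cnj b) (cnj d))"
  have add: "cowen_adjoint a b c d (f + g) = cowen_adjoint a b c d f + cowen_adjoint a b c d g" for f g
  proof (rule hardy2_eqI)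
    show "hardy_fun (cowen_adjoint a b c d (f + g)) z =
        hardy_fun (cowen_adjoint a b c d f + cowen_adjoint a b c d g) z" for z
      by (cases "z \<in> ball 0 1")
        (simp_all add: hardy_fun_cowen_adjoint [OF dm] hardy_fun_add backshift_add
          hardy_fun_outside algebra_simps add_divide_distrib)
  qed
  have scale: "cowen_adjoint a b c d (r *\<^sub>H f) = r *\<^sub>H cowen_adjoint a b c d f" for r f
  proof (rule hardy2_eqI)
    show "hardy_fun (cowen_adjoint a b c d (r *\<^sub>H f)) z = hardy_fun (r *\<^sub>H cowen_adjoint a b c d f) z" for z
      by (cases "z \<in> ball 0 1")
        (simp_all add: hardy_fun_cowen_adjoint [OF dm] hardy_fun_scale backshift_scale
          hardy_fun_outside algebra_simps add_divide_distrib)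
  qed
  show ?thesis
    unfolding Vector_Spaces.linear_iff add scale composition_add [OF dm'] composition_scale [OF dm']
    by (auto simp: hardy.vector_space_axioms hardy.scale_right_distrib hardy.scale_right_diff_distrib
        mult.commute intro: hardy.vector_space_axioms)
qed

text \<open>The Hilbert-Schmidt criterion is checked on the monomials \<open>z ^ Suc n\<close>, whose images are
  \<open>\<alpha> * V n + \<beta> * V (Suc n)\<close> with the square-summable functions \<open>V n = (z - \<eta>) * \<sigma> ^ n / D\<close>. The image of the constant
  \<open>1\<close> has another shape, but a single term does not affect summability.\<close>

lemma cowen_adjoint_diff_compact:
  assumes dm: "disk_map a b c d" and det: "a * d - b * c \<noteq> 0"
    and not_onto: "\<not> ball 0 1 \<subseteq> moebius a b c d ` ball 0 1"
    and \<zeta>: "cmod \<zeta> = 1" and \<eta>: "cmod \<eta> = 1" and \<zeta>\<eta>: "moebius a b c d \<zeta> = \<eta>"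
    and s: "s = (cnj c * cnj \<zeta> + cnj d) / (- cnj b * \<eta> + cnj d)"
  shows "compact_operator (\<lambda>f. cowen_adjoint a b c d f -
    s *\<^sub>H composition_operator (moebius (cnj a) (- cnj c) (- cnj b) (cnj d)) f)"
    (is "compact_operator ?K")
proof -
  define \<sigma> where "\<sigma> = moebius (cnj a) (- cnj c) (- cnj b) (cnj d)"
  note dm' = disk_map_krein_adjoint [OF dm]
  have cd: "cmod c < cmod d" and bd: "cmod (- cnj b) < cmod (cnj d)"
    using dm dm' by (simp_all add: disk_map_def)
  have D\<zeta>: "c * \<zeta> + d \<noteq> 0"
    using \<zeta> by (intro affine_nonzero [OF cd]) simp
  have D: "- cnj b * z + cnj d \<noteq> 0" if "z \<in> cball 0 1" for z
    by (rule affine_nonzero [OF bd that])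
  have cnj\<zeta>: "cnj \<zeta> * \<zeta> = 1" and cnj\<eta>: "cnj \<eta> * \<eta> = 1"
    using \<zeta> \<eta> complex_norm_square [of \<zeta>] complex_norm_square [of \<eta>] by (simp_all add: mult.commute)
  \<comment> \<open>\<open>\<phi> \<zeta> = \<eta>\<close> with both points on the circle is equivalent to \<open>\<sigma> \<eta> = \<zeta>\<close>.\<close>
  have N\<eta>: "cnj a * \<eta> - cnj c = \<zeta> * (- cnj b * \<eta> + cnj d)"
  proof -
    have "a * \<zeta> + b = \<eta> * (c * \<zeta> + d)"
      using \<zeta>\<eta> D\<zeta> by (simp add: moebius_def field_simps)
    then have "cnj (a * \<zeta> + b) = cnj (\<eta> * (c * \<zeta> + d))"
      by simp
    then have "(cnj a * cnj \<zeta> + cnj b) * (\<zeta> * \<eta>) = cnj \<eta> * (cnj c * cnj \<zeta> + cnj d) * (\<zeta> * \<eta>)"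
      by simp
    then have "cnj a * \<eta> * (cnj \<zeta> * \<zeta>) + cnj b * \<zeta> * \<eta> = (cnj \<eta> * \<eta>) * (cnj c * (cnj \<zeta> * \<zeta>) + cnj d * \<zeta>)"
      by (simp add: algebra_simps)
    then show ?thesis
      unfolding cnj\<zeta> cnj\<eta> by (simp add: algebra_simps)
  qed
  \<comment> \<open>This is \<open>\<kappa> \<noteq> 0\<close> for \<open>\<sigma>\<close>; otherwise \<open>\<phi>\<close> would be an automorphism.\<close>
  have cross: "- cnj b * cnj (cnj d) \<noteq> cnj a * cnj (- cnj c)"
  proof
    assume eq: "- cnj b * cnj (cnj d) = cnj a * cnj (- cnj c)"
    have "(cmod (- cnj b))\<^sup>2 + (cmod (cnj d))\<^sup>2 - ((cmod (cnj a))\<^sup>2 + (cmod (- cnj c))\<^sup>2) = 0"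
      using norm_affine_mult_defect(2) [OF dm' \<eta>] N\<eta> \<zeta> eq by (simp add: norm_mult)
    then have "ball 0 1 \<subseteq> moebius a b c d ` ball 0 1"
      using eq by (intro moebius_onto_ball [OF dm det]) simp_all
    then show False
      using not_onto by blast
  qed
  define V where "V = (\<lambda>n. affine_mult 1 (- \<eta>) (affine_div (- cnj b) (cnj d)
    (composition_operator \<sigma> (monom_hardy n))))"
  have V_summable: "summable (\<lambda>n. (norm (V n))\<^sup>2)"
    unfolding V_def \<sigma>_def
    by (rule affine_defect_summable [OF dm' \<eta> _ cross]) (use N\<eta> \<zeta> in \<open>simp add: norm_mult\<close>)
  define G where "G = 1 / (- cnj b * \<eta> + cnj d)"
  define \<alpha> where "\<alpha> = G * cnj b * cnj c - G\<^sup>2 * cnj c * cnj \<zeta> * (cnj a * cnj d - cnj b * cnj c)"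
  define \<beta> where "\<beta> = G * cnj b * cnj d"
  have K_monom: "?K (monom_hardy (Suc n)) = \<alpha> *\<^sub>H V n + \<beta> *\<^sub>H V (Suc n)" for n
  proof (rule hardy2_eqI)
    fix z
    show "hardy_fun (?K (monom_hardy (Suc n))) z = hardy_fun (\<alpha> *\<^sub>H V n + \<beta> *\<^sub>H V (Suc n)) z"
    proof (cases "z \<in> ball 0 1")
      case True
      define Dz where "Dz = - cnj b * z + cnj d"
      define w where "w = \<sigma> z"
      have w: "w \<in> ball 0 1"
        unfolding w_def \<sigma>_def by (rule moebius_in_ball [OF dm' True])
      have w_eq: "w = (cnj a * z + - cnj c) / (- cnj b * z + cnj d)"
        by (simp add: w_def \<sigma>_def moebius_def)
      have comp: "hardy_fun (composition_operator \<sigma> (monom_hardy m)) z = w ^ m" for m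
        unfolding \<sigma>_def hardy_fun_composition [OF dm' True]
        by (simp add: \<sigma>_def [symmetric] w_def [symmetric] hardy_fun_monom [OF w])
      have V_fun: "hardy_fun (V m) z = (z - \<eta>) * (w ^ m / Dz)" for m
        using True unfolding V_def Dz_def
        by (simp add: hardy_fun_affine_mult hardy_fun_affine_div [OF bd] comp)
      have "hardy_fun (?K (monom_hardy (Suc n))) z =
          (cnj c * w ^ n + cnj d * w ^ Suc n) / Dz - s * w ^ Suc n"
        unfolding hardy_fun_diff hardy_fun_scale hardy_fun_cowen_adjoint [OF dm True] backshift_monom
          \<sigma>_def [symmetric] w_def [symmetric] Dz_def comp
        by (simp only: hardy_fun_monom [OF w])
      also have "\<dots> = w ^ n * ((cnj c + cnj d * w) / Dz - s * w)"
        by (simp add: algebra_simps add_divide_distrib)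
      also have "(cnj c + cnj d * w) / Dz - s * w = (z - \<eta>) / Dz * (\<alpha> + \<beta> * w)"
        unfolding s w_eq Dz_def \<alpha>_def \<beta>_def G_def
        by (rule cowen_symbol_factor [OF D D N\<eta> cnj\<zeta>]) (use True \<eta> in simp_all)
      also have "w ^ n * ((z - \<eta>) / Dz * (\<alpha> + \<beta> * w)) = hardy_fun (\<alpha> *\<^sub>H V n + \<beta> *\<^sub>H V (Suc n)) z"
        by (simp add: hardy_fun_add hardy_fun_scale V_fun algebra_simps add_divide_distrib diff_divide_distrib)
      finally show ?thesis .
    qed (simp add: hardy_fun_outside)
  qed
  have K_le: "(norm (?K (monom_hardy (Suc n))))\<^sup>2 \<le> 2 * (cmod \<alpha>)\<^sup>2 * (norm (V n))\<^sup>2 + 2 * (cmod \<beta>)\<^sup>2 * (norm (V (Suc n)))\<^sup>2" for n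
  proof -
    define x y where "x = cmod \<alpha> * norm (V n)" and "y = cmod \<beta> * norm (V (Suc n))"
    have "norm (?K (monom_hardy (Suc n))) \<le> x + y"
      unfolding K_monom x_def y_def norm_hardy_scale [symmetric] by (rule norm_triangle_ineq)
    then have "(norm (?K (monom_hardy (Suc n))))\<^sup>2 \<le> (x + y)\<^sup>2"
      by (rule power_mono) simp
    also have "\<dots> \<le> 2 * x\<^sup>2 + 2 * y\<^sup>2"
      using sum_squares_bound [of x y] by (simp add: power2_sum)
    finally show ?thesis
      by (simp add: x_def y_def power_mult_distrib)
  qed
  have "summable (\<lambda>n. 2 * (cmod \<alpha>)\<^sup>2 * (norm (V n))\<^sup>2 + 2 * (cmod \<beta>)\<^sup>2 * (norm (V (Suc n)))\<^sup>2)"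
    using V_summable summable_Suc_iff [of "\<lambda>n. (norm (V n))\<^sup>2"]
    by (intro summable_add summable_mult) simp_all
  then have "summable (\<lambda>n. (norm (?K (monom_hardy (Suc n))))\<^sup>2)"
    by (rule summable_comparison_test' [where N = 0]) (use K_le in simp)
  then have hs: "summable (\<lambda>n. (norm (?K (monom_hardy n)))\<^sup>2)"
    by (rule iffD1 [OF summable_Suc_iff])
  obtain C1 where C1: "\<And>f. norm (cowen_adjoint a b c d f) \<le> C1 * norm f"
    using norm_cowen_adjoint_le [OF dm] by blast
  obtain C2 where C2: "\<And>f. norm (composition_operator \<sigma> f) \<le> C2 * norm f"
    using norm_composition_le [OF dm'] unfolding \<sigma>_def by blast
  show ?thesis
  proof (rule hilbert_schmidt_compact [OF linear_cowen_diff [OF dm] _ hs])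
    fix f
    have "norm (?K f) \<le> norm (cowen_adjoint a b c d f) + norm (s *\<^sub>H composition_operator \<sigma> f)"
      unfolding \<sigma>_def by (rule norm_triangle_ineq4)
    also have "\<dots> \<le> C1 * norm f + cmod s * (C2 * norm f)"
      unfolding norm_hardy_scale by (intro add_mono C1 mult_left_mono C2) simp
    finally show "norm (?K f) \<le> (C1 + cmod s * C2) * norm f"
      by (simp add: algebra_simps)
  qed
qed

theorem theorem3:
  fixes a b c d \<zeta> \<eta> s :: complex and \<phi> \<sigma> :: "complex \<Rightarrow> complex"
  assumes "a * d - b * c \<noteq> 0"
    and "\<phi> = moebius a b c d"
    and "\<phi> ` ball 0 1 \<subseteq> ball 0 1"
    and "\<phi> ` ball 0 1 \<noteq> ball 0 1"
    and "\<zeta> \<in> sphere 0 1" and "\<eta> \<in> sphere 0 1" and "\<phi> \<zeta> = \<eta>"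
    and "s = (cnj c * cnj \<zeta> + cnj d) / (- cnj b * \<eta> + cnj d)"
    and "\<sigma> = moebius (cnj a) (- cnj c) (- cnj b) (cnj d)"
  shows "\<exists>K. compact_operator K \<and>
    hardy_adjoint (composition_operator \<phi>) =
      (\<lambda>f. s *\<^sub>H composition_operator \<sigma> f + K f)"
proof (intro exI conjI)
  let ?K = "\<lambda>f. cowen_adjoint a b c d f - s *\<^sub>H composition_operator \<sigma> f"
  have dm: "disk_map a b c d"
    using assms by (intro disk_map_moebius) simp_all
  show "compact_operator ?K"
    unfolding \<open>\<sigma> = _\<close>
    by (rule cowen_adjoint_diff_compact [OF dm, of \<zeta> \<eta>]) (use assms in auto)
  show "hardy_adjoint (composition_operator \<phi>) = (\<lambda>f. s *\<^sub>H composition_operator \<sigma> f + ?K f)"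
    unfolding \<open>\<phi> = _\<close> hardy_adjoint_composition [OF dm] by simp
qed

end
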